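(* Let $n,k,s,t$ be positive integers with $n\ge2k^2$, and suppose that $k\ge5st$, or that $t=1$ and $k\ge3s$. Then every family $\mathcal F\subseteq\binom{[n]}{k}$ with $\nu(\mathcal F)\le s$ satisfies $\delta_t(\mathcal F)\le\delta_t(\mathcal A_0(n,k,s))=\binom{n-t}{k-t}-\binom{n-s-t}{k-t}$, with equality only if $\mathcal F$ is isomorphic to $\mathcal A_0(n,k,s)$.
   Context: The matching number $\nu(\mathcal F)$ is the maximum number of pairwise disjoint sets in $\mathcal F$. $\mathcal A_0(n,k,s)=\{A\in\binom{[n]}{k}:A\cap[s]\ne\emptyset\}$. For $\mathcal F\subseteq\binom{[n]}{k}$, $\delta_t(\mathcal F)$ is the minimum, over $t$-element $S\subseteq[n]$, of the number of sets of $\mathcal F$ containing $S$. Two families are isomorphic if one is the image of the other under a permutation of $[n]$. *)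

theory Defs
  imports Complex_Main "HOL-Library.Ramsey" "HOL-Library.Disjoint_Sets"
    "HOL-Combinatorics.Permutations"
begin

text \<open>
  The ground set $[n]$ is \<^term>\<open>{1..n}\<close> and the $k$-uniform families are the subsets of
  \<^term>\<open>nsets {1..n} k\<close>.
\<close>

text \<open>The maximum is meaningful for finite families only, which covers all families on $[n]$;
  the empty subfamily gives the empty family matching number 0.\<close>

definition matching_number :: "'a set set \<Rightarrow> nat" where
  "matching_number F = Max {card M | M. M \<subseteq> F \<and> disjoint M}"

text \<open>The minimum ranges over a nonempty set precisely when \<open>t \<le> n\<close>.\<close>

definition min_degree :: "nat \<Rightarrow> nat \<Rightarrow> nat set set \<Rightarrow> nat" where
  "min_degree n t F = Min {card {A \<in> F. S \<subseteq> A} | S. S \<in> [{1..n}]\<^bsup>t\<^esup>}"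

definition A0 :: "nat \<Rightarrow> nat \<Rightarrow> nat \<Rightarrow> nat set set" where
  "A0 n k s = {A \<in> [{1..n}]\<^bsup>k\<^esup>. A \<inter> {1..s} \<noteq> {}}"

definition isomorphic_families :: "nat \<Rightarrow> nat set set \<Rightarrow> nat set set \<Rightarrow> bool" where
  "isomorphic_families n F G \<longleftrightarrow> (\<exists>p. p permutes {1..n} \<and> G = (\<lambda>A. p ` A) ` F)"

end

theory Submission
  imports Defs
begin

text \<open>Averaging over all \<open>t\<close>-sets, a family whose minimum \<open>t\<close>-degree is at least that of
  \<open>A0 n k s\<close> misses the size of \<open>A0 n k s\<close> by a small multiple of
  \<open>n - s - 1 choose (k - 1)\<close> only. A Hilton--Milner type stability theorem for matchings then
  forces it to be covered by \<open>s\<close> points, and among the families with such a cover only the full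
  one attains the degree bound.

  For the stability theorem, shifting leads to a family in which the links of \<open>s + 1\<close> points are
  nested and cross-dependent, the smallest one being nonempty; sets that avoid all these points are
  controlled by Frankl's bound \<open>card F \<le> s * card (shadow F)\<close>, since their shadow lies in the
  smallest link. The links are bounded by averaging over random placements of disjoint blocks.\<close>

section \<open>Nested cross-dependent families\<close>

text \<open>With \<open>Q = (n - s - 1 - (k - 1) choose (k - 1))\<close>, the stability theorem
  says, cleared of denominators, that a family not covered by \<open>s\<close> points has at most
  \<open>(n choose k) - (n - s choose k) - (m - 2 * s - 1) / (m - s) * Q\<close> members, where
  \<open>m\<close> disjoint blocks of size \<open>k - 1\<close> must fit outside
  \<open>s + 1\<close> points. The choice \<open>m = 2 * k\<close> is what
  \<open>n \<ge> 2 * k^2\<close> pays for, and the same hypothesis makes \<open>Q\<close> at least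
  half of \<open>C = (n - s - 1 choose (k - 1))\<close>. Averaging the degrees leaves a deficiency
  of at most about \<open>s * t / k * C\<close>. Hence the contest is between
  \<open>s * t / k\<close> and half of \<open>(2 * k - 2 * s - 1) / (2 * k - s)\<close>, which is
  where the conditions \<open>k \<ge> 5 * s * t\<close> and \<open>k \<ge> 3 * s\<close> enter. The
  obstacle is that shifting may create a cover by \<open>s\<close> points, and the bound fails for
  coverable families such as \<open>A0 n k s\<close>. Shifting therefore has to stop in time, so two
  kinds of families arise, fully shifted ones and ones with a cover of \<open>s + 1\<close> points;
  both are brought to the same configuration of nested links.\<close>

lemma finite_subset_nsets: "F \<subseteq> [V]\<^bsup>k\<^esup> \<Longrightarrow> finite V \<Longrightarrow> finite F"
  by (meson finite_imp_finite_nsets finite_subset)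

lemma exists_permutes_image:
  assumes "finite V" "A \<in> [V]\<^bsup>l\<^esup>" "B \<in> [V]\<^bsup>l\<^esup>"
  shows "\<exists>p. p permutes V \<and> p ` A = B"
proof -
  have AV: "A \<subseteq> V" "finite A" "card A = l" and BV: "B \<subseteq> V" "finite B" "card B = l"
    using assms(2,3) by (auto simp: nsets_def)
  obtain f where f: "bij_betw f A B"
    using AV BV by (metis finite_same_card_bij)
  have "card (V - A) = card (V - B)"
    using AV BV by (simp add: card_Diff_subset)
  then obtain g where g: "bij_betw g (V - A) (V - B)"
    using assms(1) by (metis finite_Diff finite_same_card_bij)
  define p where "p = (\<lambda>x. if x \<in> A then f x else if x \<in> V then g x else x)"
  have pA: "bij_betw p A B"
    using f by (subst bij_betw_cong[where g = f]) (auto simp: p_def)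
  have pV: "bij_betw p (V - A) (V - B)"
    using g by (subst bij_betw_cong[where g = g]) (auto simp: p_def)
  have "bij_betw p (A \<union> (V - A)) (B \<union> (V - B))"
    by (rule bij_betw_combine[OF pA pV]) auto
  then have "bij_betw p V V"
    using AV BV by (simp add: Un_absorb1)
  then have "p permutes V"
    by (rule bij_imp_permutes) (use AV in \<open>auto simp: p_def\<close>)
  moreover have "p ` A = B"
    using pA by (rule bij_betw_imp_surj_on)
  ultimately show ?thesis by blast
qed

text \<open>A random permutation sends \<open>I\<close> to a uniformly distributed
  \<open>l\<close>-set: composing with a permutation that maps \<open>B\<close> to \<open>B'\<close>
  injects the fibre over \<open>B\<close> into the fibre over \<open>B'\<close>, so all fibres have
  equal size. Stated as a product to avoid division.\<close>

lemma card_permutes_image: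
  assumes V: "finite V" and I: "I \<in> [V]\<^bsup>l\<^esup>" and A: "A \<in> [V]\<^bsup>l\<^esup>"
  shows "card {p. p permutes V \<and> p ` I = A} * (card V choose l) = fact (card V)"
proof -
  define c where "c B = card {p. p permutes V \<and> p ` I = B}" for B
  have fin: "finite {p. p permutes V \<and> p ` I = B}" for B
    using finite_permutations[OF V] by (rule rev_finite_subset) auto
  have le: "c B \<le> c B'" if B: "B \<in> [V]\<^bsup>l\<^esup>" "B' \<in> [V]\<^bsup>l\<^esup>" for B B'
  proof -
    obtain q where q: "q permutes V" "q ` B = B'"
      using exists_permutes_image[OF V B] by blast
    have "inj_on (\<lambda>p. q \<circ> p) {p. p permutes V \<and> p ` I = B}"
      using fun.inj_map[OF permutes_inj[OF q(1)]] by (rule inj_on_subset) simp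
    moreover have "(\<lambda>p. q \<circ> p) ` {p. p permutes V \<and> p ` I = B} \<subseteq> {p. p permutes V \<and> p ` I = B'}"
      using q(2) permutes_compose[OF _ q(1)] by (auto simp: image_comp[symmetric])
    ultimately show ?thesis
      unfolding c_def using fin by (meson card_inj_on_le)
  qed
  have "{p. p permutes V} = (\<Union>B\<in>[V]\<^bsup>l\<^esup>. {p. p permutes V \<and> p ` I = B})"
  proof -
    have "p ` I \<in> [V]\<^bsup>l\<^esup>" if "p permutes V" for p
    proof -
      have "inj_on p I"
        using permutes_inj[OF that] by (rule inj_on_subset) simp
      then show ?thesis
        using I permutes_image[OF that] by (auto simp: nsets_def card_image)
    qed
    then show ?thesis by auto
  qed
  then have "card {p. p permutes V} = (\<Sum>B\<in>[V]\<^bsup>l\<^esup>. c B)"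
    unfolding c_def using fin V
    by (simp only:) (rule card_UN_disjoint, auto simp: finite_imp_finite_nsets)
  also have "\<dots> = (\<Sum>B\<in>[V]\<^bsup>l\<^esup>. c A)"
    by (rule sum.cong) (use le A in \<open>auto intro: antisym\<close>)
  also have "\<dots> = (card V choose l) * c A"
    using card_nsets[of V l] V by simp
  finally show ?thesis
    using card_permutations[OF refl V] by (simp add: c_def mult.commute)
qed

text \<open>At most \<open>j\<close> elements have been used when the turn of \<open>E j\<close>
  comes, so one of its more than \<open>j\<close> elements is still free.\<close>

lemma greedy_representatives:
  fixes E :: "nat \<Rightarrow> 'b set"
  assumes "\<And>j. j \<le> r \<Longrightarrow> finite (E j) \<and> j < card (E j)"
  shows "\<exists>f. inj_on f {..r} \<and> (\<forall>j\<le>r. f j \<in> E j)"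
  using assms
proof (induction r)
  case 0
  then have "E 0 \<noteq> {}" by force
  then show ?case by (auto simp: ex_in_conv[symmetric])
next
  case (Suc r)
  then obtain f where f: "inj_on f {..r}" "\<forall>j\<le>r. f j \<in> E j"
    by force
  have "card (f ` {..r}) \<le> Suc r"
    using card_image_le[of "{..r}" f] by simp
  also have "\<dots> < card (E (Suc r))"
    using Suc.prems[of "Suc r"] by simp
  finally have "\<not> E (Suc r) \<subseteq> f ` {..r}"
    by (meson card_mono finite_imageI finite_atMost not_le)
  then obtain y where y: "y \<in> E (Suc r)" "y \<notin> f ` {..r}" by blast
  have "inj_on (f(Suc r := y)) {..Suc r}"
    using f(1) y(2) by (auto simp: inj_on_def atMost_Suc le_Suc_eq)
  moreover have "\<forall>j\<le>Suc r. (f(Suc r := y)) j \<in> E j"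
    using f(2) y(1) by (auto simp: le_Suc_eq)
  ultimately show ?case by blast
qed

lemma exists_disjoint_blocks:
  assumes "finite V" "m * l \<le> card V"
  shows "\<exists>I. (\<forall>b<m. I b \<in> [V]\<^bsup>l\<^esup>) \<and> (\<forall>a<m. \<forall>b<m. a \<noteq> b \<longrightarrow> I a \<inter> I b = {})"
  using assms
proof (induction m arbitrary: V)
  case 0
  then show ?case by simp
next
  case (Suc m)
  obtain B where B: "B \<subseteq> V" "card B = l" "finite B"
    using Suc.prems by (metis le_add1 mult_Suc obtain_subset_with_card_n order.trans)
  have "m * l \<le> card (V - B)"
    using Suc.prems B by (simp add: card_Diff_subset)
  then obtain I where I: "\<forall>b<m. I b \<in> [V - B]\<^bsup>l\<^esup>" "\<forall>a<m. \<forall>b<m. a \<noteq> b \<longrightarrow> I a \<inter> I b = {}"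
    using Suc.IH[of "V - B"] Suc.prems by auto
  show ?case
    by (rule exI[of _ "I(m := B)"]) (use I B in \<open>auto simp: nsets_def less_Suc_eq\<close>)
qed

text \<open>Frankl's inequality. Averaging over all placements of \<open>m\<close> disjoint blocks reduces it to a
  single placement; there, if the greedy choice of distinct blocks fails at the family \<open>j\<close>, then
  each of the families \<open>0,\<dots>,j\<close> owns at most \<open>j\<close> blocks.\<close>

lemma nested_cross_dependent_bound:
  fixes G :: "nat \<Rightarrow> 'a set set"
  assumes V: "finite V" and m: "m * l \<le> card V" and r: "r < m"
    and G: "\<And>j. j \<le> r \<Longrightarrow> G j \<subseteq> [V]\<^bsup>l\<^esup>"
    and nested: "\<And>i j. i \<le> j \<Longrightarrow> j \<le> r \<Longrightarrow> G i \<subseteq> G j"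
    and dep: "\<not> (\<exists>A. (\<forall>j\<le>r. A j \<in> G j) \<and> (\<forall>i\<le>r. \<forall>j\<le>r. i \<noteq> j \<longrightarrow> A i \<inter> A j = {}))"
  shows "(\<Sum>j=1..r. card (G j)) + (m - r) * card (G 0) \<le> r * (card V choose l)"
proof -
  obtain I where I: "\<And>b. b < m \<Longrightarrow> I b \<in> [V]\<^bsup>l\<^esup>"
    and Idisj: "\<And>a b. a < m \<Longrightarrow> b < m \<Longrightarrow> a \<noteq> b \<Longrightarrow> I a \<inter> I b = {}"
    using exists_disjoint_blocks[OF V m] by blast
  define P where "P = {p. p permutes V}"
  have finP: "finite P"
    unfolding P_def by (rule finite_permutations[OF V])
  define E where "E p j = {b. b < m \<and> p ` I b \<in> G j}" for p j
  have finE: "finite (E p j)" and E_le: "card (E p j) \<le> m" for p j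
    using card_mono[of "{..<m}" "E p j"] by (auto simp: E_def)
  have "(\<Sum>j=1..r. card (E p j)) + (m - r) * card (E p 0) \<le> r * m" if p: "p \<in> P" for p
  proof -
    have "\<exists>j\<le>r. card (E p j) \<le> j"
    proof (rule ccontr)
      assume "\<not> (\<exists>j\<le>r. card (E p j) \<le> j)"
      then have "\<And>j. j \<le> r \<Longrightarrow> finite (E p j) \<and> j < card (E p j)"
        using finE by force
      from greedy_representatives[OF this]
      obtain f where f: "inj_on f {..r}" "\<forall>j\<le>r. f j \<in> E p j"
        by blast
      have "p ` I (f i) \<inter> p ` I (f j) = {}" if "i \<le> r" "j \<le> r" "i \<noteq> j" for i j
      proof -
        have "f i \<noteq> f j" using f(1) that by (auto simp: inj_on_def)
        moreover have "f i < m" "f j < m" using f(2) that by (auto simp: E_def)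
        ultimately have "I (f i) \<inter> I (f j) = {}" by (rule Idisj[rotated 2])
        moreover have "inj p" using p by (auto simp: P_def permutes_inj)
        ultimately show ?thesis by (metis image_Int image_empty)
      qed
      moreover have "\<forall>j\<le>r. p ` I (f j) \<in> G j"
        using f(2) by (auto simp: E_def)
      ultimately show False
        by - (rule notE[OF dep], rule exI[of _ "\<lambda>j. p ` I (f j)"], blast)
    qed
    then obtain j where j: "j \<le> r" "card (E p j) \<le> j" by blast
    have small: "card (E p i) \<le> j" if "i \<le> j" for i
    proof -
      have "E p i \<subseteq> E p j" using nested[OF that j(1)] by (auto simp: E_def)
      then show ?thesis using card_mono[OF finE] j(2) by (meson order.trans)
    qed
    have "(\<Sum>i=1..r. card (E p i)) = (\<Sum>i=1..j. card (E p i)) + (\<Sum>i=Suc j..r. card (E p i))"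
      using j(1) by (subst sum.union_disjoint[symmetric]) (auto intro: sum.cong)
    also have "\<dots> \<le> (\<Sum>i=1..j. j) + (\<Sum>i=Suc j..r. m)"
      by (intro add_mono sum_mono) (auto simp: small E_le)
    also have "\<dots> = j * j + (r - j) * m" by simp
    finally have "(\<Sum>i=1..r. card (E p i)) + (m - r) * card (E p 0) \<le> j * j + (r - j) * m + (m - r) * j"
      using small[of 0] by (simp add: add_mono)
    \<comment> \<open>The difference of the two sides is \<open>j * (r - j)\<close>.\<close>
    also have "\<dots> \<le> r * m"
    proof -
      obtain d where d: "r = j + d" using j(1) le_Suc_ex by blast
      obtain u where u: "m = r + u" using r less_imp_le le_Suc_ex by blast
      show ?thesis unfolding u d by (simp add: algebra_simps)
    qed
    finally show ?thesis .
  qed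
  then have "(\<Sum>p\<in>P. (\<Sum>j=1..r. card (E p j)) + (m - r) * card (E p 0)) \<le> (\<Sum>p\<in>P. r * m)"
    by (rule sum_mono)
  then have total: "(\<Sum>j=1..r. \<Sum>p\<in>P. card (E p j)) + (m - r) * (\<Sum>p\<in>P. card (E p 0))
      \<le> r * m * fact (card V)"
    using card_permutations[OF refl V] sum.swap[of "\<lambda>p j. card (E p j)" "{1..r}" P]
    by (simp add: sum.distrib sum_distrib_left[symmetric] P_def mult.commute mult.left_commute)
  \<comment> \<open>Linearity of expectation: each of the \<open>m\<close> blocks lands in
    \<open>G j\<close> with probability \<open>card (G j) / (card V choose l)\<close>.\<close>
  have avg: "(\<Sum>p\<in>P. card (E p j)) * (card V choose l) = m * card (G j) * fact (card V)"
    if j: "j \<le> r" for j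
  proof -
    have finG: "finite (G j)" using finite_subset_nsets[OF G[OF j] V] .
    have "card (E p j) = (\<Sum>b<m. \<Sum>A\<in>G j. if p ` I b = A then 1 else 0)" for p
    proof -
      have "(\<Sum>b<m. \<Sum>A\<in>G j. if p ` I b = A then 1 else 0) = (\<Sum>b<m. if p ` I b \<in> G j then 1 else (0::nat))"
        using finG by (simp add: sum.delta')
      also have "\<dots> = card (E p j)"
        by (simp add: sum.If_cases E_def Int_def lessThan_def)
      finally show ?thesis by simp
    qed
    then have "(\<Sum>p\<in>P. card (E p j)) = (\<Sum>p\<in>P. \<Sum>b<m. \<Sum>A\<in>G j. if p ` I b = A then 1 else 0)"
      by simp
    also have "\<dots> = (\<Sum>b<m. \<Sum>A\<in>G j. \<Sum>p\<in>P. if p ` I b = A then 1 else 0)"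
      by (subst sum.swap, rule sum.cong[OF refl], rule sum.swap)
    also have "\<dots> = (\<Sum>b<m. \<Sum>A\<in>G j. card {p. p permutes V \<and> p ` I b = A})"
      using finP by (simp add: sum.If_cases P_def Int_def)
    finally have "(\<Sum>p\<in>P. card (E p j)) * (card V choose l)
        = (\<Sum>b<m. \<Sum>A\<in>G j. card {p. p permutes V \<and> p ` I b = A} * (card V choose l))"
      by (simp add: sum_distrib_right)
    also have "\<dots> = (\<Sum>b<m. \<Sum>A\<in>G j. fact (card V))"
      by (intro sum.cong refl card_permutes_image[OF V]) (use I G[OF j] in auto)
    finally show ?thesis by simp
  qed
  let ?C = "card V choose l"
  have "((\<Sum>j=1..r. card (G j)) + (m - r) * card (G 0)) * (m * fact (card V))
      = (\<Sum>j=1..r. m * card (G j) * fact (card V)) + (m - r) * (m * card (G 0) * fact (card V))"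
    by (simp add: algebra_simps sum_distrib_left sum_distrib_right)
  also have "\<dots> = (\<Sum>j=1..r. (\<Sum>p\<in>P. card (E p j)) * ?C) + (m - r) * ((\<Sum>p\<in>P. card (E p 0)) * ?C)"
    using avg by (simp cong: sum.cong_simp)
  also have "\<dots> = ((\<Sum>j=1..r. \<Sum>p\<in>P. card (E p j)) + (m - r) * (\<Sum>p\<in>P. card (E p 0))) * ?C"
    by (simp add: algebra_simps sum_distrib_left sum_distrib_right)
  also have "\<dots> \<le> r * m * fact (card V) * ?C"
    using total by (rule mult_right_mono) simp
  finally have "((\<Sum>j=1..r. card (G j)) + (m - r) * card (G 0)) * (m * fact (card V))
      \<le> (r * ?C) * (m * fact (card V))"
    by (simp add: algebra_simps)
  then show ?thesis
    using r by simp
qed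

section \<open>Shadows of shifted families\<close>

lemma matching_number_le_iff:
  assumes "finite F"
  shows "matching_number F \<le> s \<longleftrightarrow> (\<forall>M\<subseteq>F. disjoint M \<longrightarrow> card M \<le> s)"
proof -
  have "{card M | M. M \<subseteq> F \<and> disjoint M} \<subseteq> card ` Pow F" by blast
  then have "finite {card M | M. M \<subseteq> F \<and> disjoint M}"
    using assms by (meson finite_Pow_iff finite_imageI finite_subset)
  moreover have "{card M | M. M \<subseteq> F \<and> disjoint M} \<noteq> {}"
    by (auto intro!: exI[of _ "{}"])
  ultimately show ?thesis
    unfolding matching_number_def by (subst Max_le_iff) auto
qed

lemma disjoint_family_card_le_matching_number:
  assumes "finite F" "matching_number F \<le> s" "M \<subseteq> F" "disjoint M"
  shows "card M \<le> s"
  using assms matching_number_le_iff by blast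

text \<open>Relative to a set \<open>V\<close>, because shifting is at times confined to a cover or
  to its complement, and because the induction for the shadow bound removes points.\<close>

definition shifted_on :: "nat set \<Rightarrow> nat set set \<Rightarrow> bool" where
  "shifted_on V F \<longleftrightarrow>
    (\<forall>a\<in>V. \<forall>b\<in>V. \<forall>A\<in>F. a < b \<longrightarrow> b \<in> A \<longrightarrow> a \<notin> A \<longrightarrow> insert a (A - {b}) \<in> F)"

lemma shifted_onD:
  "shifted_on V F \<Longrightarrow> a \<in> V \<Longrightarrow> b \<in> V \<Longrightarrow> a < b \<Longrightarrow> A \<in> F \<Longrightarrow> b \<in> A \<Longrightarrow> a \<notin> A \<Longrightarrow>
    insert a (A - {b}) \<in> F"
  by (auto simp: shifted_on_def)

definition shadow :: "'a set set \<Rightarrow> 'a set set" where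
  "shadow F = {A - {a} | A a. A \<in> F \<and> a \<in> A}"

lemma shadow_mono: "F \<subseteq> G \<Longrightarrow> shadow F \<subseteq> shadow G"
  by (auto simp: shadow_def)

lemma shadow_nsets: "F \<subseteq> [V]\<^bsup>k\<^esup> \<Longrightarrow> shadow F \<subseteq> nsets V (k - 1)"
  by (fastforce simp: shadow_def nsets_def)

text \<open>Counts pairs of a member and one of its points; a set of the shadow extends by at most
  \<open>card V - (k - 1)\<close> points. This settles the shadow bound on small ground
  sets.\<close>

lemma shadow_double_count:
  assumes V: "finite V" and F: "F \<subseteq> [V]\<^bsup>k\<^esup>"
  shows "k * card F \<le> (card V - (k - 1)) * card (shadow F)"
proof -
  let ?X = "SIGMA A:F. A" and ?Y = "SIGMA B:shadow F. V - B"
  have finF: "finite F" and finS: "finite (shadow F)"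
    using F V shadow_nsets[OF F] finite_subset_nsets by blast+
  have finA: "finite A" if "A \<in> F" for A
    using that F by (auto simp: nsets_def)
  have "k * card F = card ?X"
  proof -
    have "card ?X = (\<Sum>A\<in>F. card A)"
      using finF finA by (subst card_SigmaI) auto
    also have "\<dots> = (\<Sum>A\<in>F. k)"
      using F by (intro sum.cong refl) (auto simp: nsets_def)
    finally show ?thesis by simp
  qed
  also have "\<dots> \<le> card ?Y"
  proof (rule card_inj_on_le)
    show "inj_on (\<lambda>(A, a). (A - {a}, a)) ?X"
      by (rule inj_on_inverseI[where g = "\<lambda>(B, a). (insert a B, a)"]) (auto simp: insert_absorb)
    show "(\<lambda>(A, a). (A - {a}, a)) ` ?X \<subseteq> ?Y"
      using F by (auto simp: shadow_def nsets_def)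
    show "finite ?Y"
      using finS V by auto
  qed
  also have "\<dots> = (\<Sum>B\<in>shadow F. card (V - B))"
    using finS V by (subst card_SigmaI) auto
  also have "\<dots> = (\<Sum>B\<in>shadow F. card V - (k - 1))"
    using shadow_nsets[OF F] by (intro sum.cong refl) (auto simp: nsets_def card_Diff_subset)
  finally show ?thesis by (simp add: mult.commute)
qed

text \<open>Disjoint sets in the link of \<open>Max V\<close> become disjoint members of the family when the common
  point \<open>Max V\<close> is shifted down to distinct unused points.\<close>

lemma shifted_matching_extend:
  assumes V: "finite V" "V \<noteq> {}" and F: "F \<subseteq> [V]\<^bsup>k\<^esup>" and sh: "shifted_on V F"
    and M: "finite M" "disjoint M" "\<And>A. A \<in> M \<Longrightarrow> Max V \<notin> A \<and> insert (Max V) A \<in> F"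
    and k: "2 \<le> k" and big: "k * card M \<le> card V"
  shows "\<exists>M'\<subseteq>F. disjoint M' \<and> card M' = card M"
proof -
  let ?v = "Max V"
  have A: "A \<subseteq> V" "finite A" "card A = k - 1" if "A \<in> M" for A
    using M(3)[OF that] F by (auto simp: nsets_def)
  have "card (\<Union>M) = (\<Sum>A\<in>M. card A)"
    using M(2) A by (intro card_Union_disjoint) auto
  also have "\<dots> = (k - 1) * card M"
    using A by simp
  finally have cU: "card (\<Union>M) = (k - 1) * card M" .
  have "card M + (k - 1) * card M = k * card M"
    using k by (metis Suc_diff_1 mult_Suc pos2 order.strict_trans2)
  moreover have "card (V - \<Union>M) = card V - card (\<Union>M)"
    using A V(1) by (intro card_Diff_subset) (auto intro: finite_subset[of _ V])
  ultimately have "card M \<le> card (V - \<Union>M)"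
    using big cU by linarith
  then obtain f where f: "f ` M \<subseteq> V - \<Union>M" "inj_on f M"
    using card_le_inj[OF M(1)] V(1) by blast
  define h where "h A = insert (f A) A" for A
  have hF: "h A \<in> F" if AM: "A \<in> M" for A
  proof (cases "f A = ?v")
    case True
    then show ?thesis using M(3)[OF AM] by (simp add: h_def)
  next
    case False
    have fA: "f A \<in> V" "f A \<notin> A" using f(1) AM by auto
    then have "f A < ?v" using False Max_ge[OF V(1), of "f A"] by simp
    then have "insert (f A) (insert ?v A - {?v}) \<in> F"
      using shifted_onD[OF sh fA(1) Max_in[OF V], of "insert ?v A"] M(3)[OF AM] fA by auto
    then show ?thesis using M(3)[OF AM] by (simp add: h_def)
  qed
  have disj: "h A \<inter> h B = {}" if "A \<in> M" "B \<in> M" "A \<noteq> B" for A B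
  proof -
    have "f A \<noteq> f B" using f(2) that by (auto simp: inj_on_def)
    moreover have "A \<inter> B = {}" using M(2) that by (auto dest: disjointD)
    ultimately show ?thesis using f(1) that by (auto simp: h_def)
  qed
  have "inj_on h M"
  proof (rule inj_onI)
    fix A B assume "A \<in> M" "B \<in> M" "h A = h B"
    moreover have "h A \<noteq> {}" by (simp add: h_def)
    ultimately show "A = B" using disj[of A B] by auto
  qed
  then have "card (h ` M) = card M" by (rule card_image)
  moreover have "disjoint (h ` M)" using disj by (auto intro!: disjointI)
  ultimately show ?thesis using hF by blast
qed

lemma card_le_shadow:
  assumes "finite V" "F \<subseteq> [V]\<^bsup>k\<^esup>" "shifted_on V F" "1 \<le> k" "matching_number F \<le> s"
  shows "card F \<le> s * card (shadow F)"
  using assms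
proof (induction "card V" arbitrary: V F k rule: less_induct)
  case less
  note V = less.prems(1) and F = less.prems(2) and sh = less.prems(3) and k = less.prems(4)
  have finF: "finite F" using finite_subset_nsets[OF F V] .
  have nu: "card M \<le> s" if "M \<subseteq> F" "disjoint M" for M
    using disjoint_family_card_le_matching_number[OF finF less.prems(5) that] .
  have finS: "finite (shadow F)" using finite_subset_nsets[OF shadow_nsets[OF F] V] .
  consider "F = {}" | "F \<noteq> {}" "k = 1" | "card V < k * (s + 1)" | "2 \<le> k" "k * (s + 1) \<le> card V"
    using k by linarith
  then show ?case
  proof cases
    case 1
    then show ?thesis by simp
  next
    case 2
    then have single: "\<exists>x. A = {x}" if "A \<in> F" for A
      using that F by (auto simp: nsets_def card_1_singleton_iff)
    have "A \<inter> B = {}" if "A \<in> F" "B \<in> F" "A \<noteq> B" for A B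
      using single[OF that(1)] single[OF that(2)] that(3) by auto
    then have "card F \<le> s" using nu[of F] by (auto intro: disjointI)
    moreover have "shadow F \<noteq> {}"
    proof -
      obtain A x where "A \<in> F" "A = {x}" using single 2 by blast
      then show ?thesis by (auto simp: shadow_def)
    qed
    ultimately show ?thesis
      using finS by (metis One_nat_def Suc_leI card_gt_0_iff le_trans mult.right_neutral mult_le_mono2)
  next
    case 3
    \<comment> \<open>Here \<open>card V \<le> k * (s + 1) - 1\<close>, and the factor
      \<open>k\<close> cancels against the double count.\<close>
    then have "card V - (k - 1) \<le> k * s" using k by simp
    then have "k * card F \<le> k * s * card (shadow F)"
      using shadow_double_count[OF V F] by (meson le_trans mult_le_mono1)
    then show ?thesis using k by simp
  next
    case 4
    then have "V \<noteq> {}" by auto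
    define v where "v = Max V"
    have v: "v \<in> V" "\<And>x. x \<in> V \<Longrightarrow> x \<noteq> v \<Longrightarrow> x < v"
      using V \<open>V \<noteq> {}\<close> Max_ge[OF V] unfolding v_def by (auto simp: order.strict_iff_order)
    define F0 where "F0 = {A \<in> F. v \<notin> A}"
    define F1 where "F1 = (\<lambda>A. A - {v}) ` {A \<in> F. v \<in> A}"
    have lt: "card (V - {v}) < card V" using V v(1) by (rule card_Diff1_less)
    have F0: "F0 \<subseteq> [V - {v}]\<^bsup>k\<^esup>" and F1: "F1 \<subseteq> nsets (V - {v}) (k - 1)"
      using F by (auto simp: F0_def F1_def nsets_def)
    have F1_iff: "B \<in> F1 \<longleftrightarrow> v \<notin> B \<and> insert v B \<in> F" for B
      by (auto simp: F1_def insert_absorb intro!: rev_image_eqI[of "insert v B"])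
    have sh0: "shifted_on (V - {v}) F0"
      using sh by (auto simp: shifted_on_def F0_def)
    have sh1: "shifted_on (V - {v}) F1"
      unfolding shifted_on_def
    proof (intro ballI impI)
      fix a b A assume ab: "a \<in> V - {v}" "b \<in> V - {v}" "A \<in> F1" "a < b" "b \<in> A" "a \<notin> A"
      then have "insert a (insert v A - {b}) \<in> F"
        by (intro shifted_onD[OF sh]) (auto simp: F1_iff)
      also have "insert a (insert v A - {b}) = insert v (insert a (A - {b}))"
        using ab by auto
      finally show "insert a (A - {b}) \<in> F1"
        using ab by (auto simp: F1_iff)
    qed
    have fin0: "finite F0" and fin1: "finite F1"
      using finF by (auto simp: F0_def F1_def)
    have nu0: "matching_number F0 \<le> s"
      unfolding matching_number_le_iff[OF fin0] using nu by (auto simp: F0_def)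
    have nu1: "matching_number F1 \<le> s"
      unfolding matching_number_le_iff[OF fin1]
    proof (intro allI impI, rule ccontr)
      fix M assume M: "M \<subseteq> F1" "disjoint M" "\<not> card M \<le> s"
      \<comment> \<open>Trimming to exactly \<open>s + 1\<close> sets guarantees room for the
        \<open>s + 1\<close> replacement points of \<open>v\<close>.\<close>
      then obtain M1 where M1: "M1 \<subseteq> M" "card M1 = s + 1" "finite M1"
        by (metis Suc_eq_plus1 not_less_eq_eq obtain_subset_with_card_n)
      have "\<exists>M'\<subseteq>F. disjoint M' \<and> card M' = card M1"
      proof (rule shifted_matching_extend[OF V \<open>V \<noteq> {}\<close> F sh M1(3)])
        show "disjoint M1" using M(2) M1(1) by (rule pairwise_subset)
        show "Max V \<notin> A \<and> insert (Max V) A \<in> F" if "A \<in> M1" for A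
          using that M1(1) M(1) F1_iff unfolding v_def by blast
        show "2 \<le> k" "k * card M1 \<le> card V" using 4 M1(2) by simp_all
      qed
      then show False using nu M1(2) by (metis Suc_eq_plus1 not_less_eq_eq order_refl)
    qed
    have "card F0 \<le> s * card (shadow F0)"
      using less.hyps[OF lt _ F0 sh0 k nu0] V by simp
    moreover have "card F1 \<le> s * card (shadow F1)"
      using less.hyps[OF lt _ F1 sh1 _ nu1] V 4 by simp
    moreover have "card F = card F0 + card F1"
    proof -
      have "inj_on (\<lambda>A. A - {v}) {A \<in> F. v \<in> A}"
        by (rule inj_on_inverseI[where g = "insert v"]) (auto simp: insert_absorb)
      then have "card F1 = card {A \<in> F. v \<in> A}"
        unfolding F1_def by (rule card_image)
      moreover have "F = F0 \<union> {A \<in> F. v \<in> A}" "F0 \<inter> {A \<in> F. v \<in> A} = {}"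
        by (auto simp: F0_def)
      ultimately show ?thesis
        using finF fin0 by (metis (no_types, lifting) card_Un_disjoint finite_Un)
    qed
    moreover have "s * card (shadow F0) + s * card (shadow F1) \<le> s * card (shadow F)"
      unfolding distrib_left[symmetric]
    proof (rule mult_le_mono2)
      have nv0: "v \<notin> B" if "B \<in> shadow F0" for B
        using that by (auto simp: shadow_def F0_def)
      have nv1: "v \<notin> B" if "B \<in> shadow F1" for B
        using that by (auto simp: shadow_def F1_iff)
      have "insert v (A - {a}) = insert v A - {a}" if "a \<noteq> v" for A a
        using that by auto
      then have "insert v ` shadow F1 \<subseteq> shadow F"
        unfolding shadow_def by (auto simp: F1_iff) (metis insertCI)
      moreover have "shadow F0 \<subseteq> shadow F"
        by (rule shadow_mono) (auto simp: F0_def)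
      ultimately have sub: "shadow F0 \<union> insert v ` shadow F1 \<subseteq> shadow F" by blast
      have "inj_on (insert v) (shadow F1)"
        using nv1 by (intro inj_on_inverseI[where g = "\<lambda>B. B - {v}"]) auto
      then have "card (shadow F0) + card (shadow F1) = card (shadow F0) + card (insert v ` shadow F1)"
        by (simp add: card_image)
      also have "\<dots> = card (shadow F0 \<union> insert v ` shadow F1)"
        using nv0 sub finS by (intro card_Un_disjoint[symmetric]) (auto dest: finite_subset)
      also have "\<dots> \<le> card (shadow F)"
        using sub finS by (rule card_mono[rotated])
      finally show "card (shadow F0) + card (shadow F1) \<le> card (shadow F)" .
    qed
    ultimately show ?thesis by linarith
  qed
qed

section \<open>Families with nested links\<close>

text \<open>For \<open>x\<close> in \<open>T\<close> and \<open>V\<close> the complement of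
  \<open>T\<close>, this describes the members whose trace on \<open>T\<close> is exactly
  \<open>{x}\<close>, so links of different points count different members.\<close>

definition link :: "'a set \<Rightarrow> 'a \<Rightarrow> 'a set set \<Rightarrow> 'a set set" where
  "link V x F = {A. A \<subseteq> V \<and> insert x A \<in> F}"

lemma link_nsets:
  assumes "F \<subseteq> [W]\<^bsup>k\<^esup>" "x \<notin> V"
  shows "link V x F \<subseteq> nsets V (k - 1)"
proof
  fix A assume "A \<in> link V x F"
  then have "A \<subseteq> V" "insert x A \<in> [W]\<^bsup>k\<^esup>" using assms(1) by (auto simp: link_def)
  moreover from this have "x \<notin> A" using assms(2) by auto
  ultimately show "A \<in> nsets V (k - 1)" by (auto simp: nsets_def)
qed

lemma link_all_nsets:
  assumes "x \<in> T" "T \<inter> V = {}" "1 \<le> k"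
  shows "link V x ([T \<union> V]\<^bsup>k\<^esup>) = nsets V (k - 1)"
proof
  show "link V x ([T \<union> V]\<^bsup>k\<^esup>) \<subseteq> nsets V (k - 1)"
    by (rule link_nsets) (use assms in auto)
  show "nsets V (k - 1) \<subseteq> link V x ([T \<union> V]\<^bsup>k\<^esup>)"
  proof
    fix A assume A: "A \<in> nsets V (k - 1)"
    then have "x \<notin> A" using assms by (auto simp: nsets_def)
    then show "A \<in> link V x ([T \<union> V]\<^bsup>k\<^esup>)"
      using A assms by (auto simp: nsets_def link_def)
  qed
qed

text \<open>Applied both to \<open>F\<close> and to the complete family; traces of size at least 2
  are bounded by those of the complete family, so they cancel in the comparison.\<close>

lemma card_split_by_trace:
  assumes T: "finite T" and V: "finite V" and TV: "T \<inter> V = {}" and F: "F \<subseteq> [T \<union> V]\<^bsup>k\<^esup>"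
  shows "card F = card {A \<in> F. A \<inter> T = {}} + (\<Sum>x\<in>T. card (link V x F))
    + card {A \<in> F. 2 \<le> card (A \<inter> T)}"
proof -
  let ?F1 = "\<lambda>x. {A \<in> F. A \<inter> T = {x}}"
  have finF: "finite F" using finite_subset_nsets[OF F] T V by simp
  have "card (?F1 x) = card (link V x F)" if "x \<in> T" for x
  proof -
    have "?F1 x = insert x ` link V x F"
    proof
      show "insert x ` link V x F \<subseteq> ?F1 x" using TV that by (auto simp: link_def)
      show "?F1 x \<subseteq> insert x ` link V x F"
      proof
        fix A assume A: "A \<in> ?F1 x"
        then have eq: "A = insert x (A - {x})" by auto
        have "A \<subseteq> T \<union> V" using A F by (auto simp: nsets_def)
        then have "A - {x} \<subseteq> V" using A by blast
        then have "A - {x} \<in> link V x F" using A eq by (simp add: link_def)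
        with eq show "A \<in> insert x ` link V x F" by blast
      qed
    qed
    moreover have "inj_on (insert x) (link V x F)"
      using TV that by (intro inj_on_inverseI[where g = "\<lambda>B. B - {x}"]) (auto simp: link_def)
    ultimately show ?thesis by (simp add: card_image)
  qed
  then have "(\<Sum>x\<in>T. card (link V x F)) = (\<Sum>x\<in>T. card (?F1 x))"
    by simp
  also have "\<dots> = card (\<Union>x\<in>T. ?F1 x)"
    using T finF by (intro card_UN_disjoint[symmetric]) auto
  also have "(\<Union>x\<in>T. ?F1 x) = {A \<in> F. card (A \<inter> T) = 1}"
    by (auto simp: card_1_singleton_iff)
  finally have one: "(\<Sum>x\<in>T. card (link V x F)) = card {A \<in> F. card (A \<inter> T) = 1}" .
  have zero: "A \<inter> T = {} \<longleftrightarrow> card (A \<inter> T) = 0" for A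
    using T by simp
  have "F = ({A \<in> F. A \<inter> T = {}} \<union> {A \<in> F. card (A \<inter> T) = 1}) \<union> {A \<in> F. 2 \<le> card (A \<inter> T)}"
    unfolding zero by auto
  then have "card F = card (({A \<in> F. A \<inter> T = {}} \<union> {A \<in> F. card (A \<inter> T) = 1}) \<union> {A \<in> F. 2 \<le> card (A \<inter> T)})"
    by simp
  also have "\<dots> = card ({A \<in> F. A \<inter> T = {}} \<union> {A \<in> F. card (A \<inter> T) = 1}) + card {A \<in> F. 2 \<le> card (A \<inter> T)}"
    using finF by (intro card_Un_disjoint) auto
  also have "card ({A \<in> F. A \<inter> T = {}} \<union> {A \<in> F. card (A \<inter> T) = 1})
      = card {A \<in> F. A \<inter> T = {}} + card {A \<in> F. card (A \<inter> T) = 1}"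
    using finF by (intro card_Un_disjoint) auto
  finally show ?thesis using one by simp
qed

text \<open>Disjoint representatives of the \<open>s + 1\<close> links, each completed by its own
  point \<open>g j\<close>, would form \<open>s + 1\<close> disjoint members of
  \<open>F\<close>.\<close>

lemma links_cross_dependent:
  assumes TV: "g ` {..s} \<inter> V = {}" "inj_on g {..s}" and F: "finite F" "matching_number F \<le> s"
  shows "\<not> (\<exists>A. (\<forall>j\<le>s. A j \<in> link V (g j) F) \<and> (\<forall>i\<le>s. \<forall>j\<le>s. i \<noteq> j \<longrightarrow> A i \<inter> A j = {}))"
proof
  assume "\<exists>A. (\<forall>j\<le>s. A j \<in> link V (g j) F) \<and> (\<forall>i\<le>s. \<forall>j\<le>s. i \<noteq> j \<longrightarrow> A i \<inter> A j = {})"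
  then obtain A where A: "\<forall>j\<le>s. A j \<in> link V (g j) F"
    and disj: "\<forall>i\<le>s. \<forall>j\<le>s. i \<noteq> j \<longrightarrow> A i \<inter> A j = {}"
    by blast
  define h where "h j = insert (g j) (A j)" for j
  have AV: "A j \<subseteq> V" "h j \<in> F" if "j \<le> s" for j
    using A that by (auto simp: link_def h_def)
  have hd: "h i \<inter> h j = {}" if "i \<le> s" "j \<le> s" "i \<noteq> j" for i j
  proof -
    have "g i \<noteq> g j" using TV(2) that by (auto simp: inj_on_def)
    moreover have "g i \<notin> V" "g j \<notin> V" using TV(1) that by auto
    ultimately show ?thesis
      using AV(1)[OF that(1)] AV(1)[OF that(2)] disj that unfolding h_def by blast
  qed
  have "inj_on h {..s}"
  proof (rule inj_onI)
    fix i j assume "i \<in> {..s}" "j \<in> {..s}" "h i = h j"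
    moreover have "h i \<noteq> {}" by (simp add: h_def)
    ultimately show "i = j" using hd[of i j] by auto
  qed
  then have "card (h ` {..s}) = s + 1" by (simp add: card_image)
  moreover have "card (h ` {..s}) \<le> s"
  proof (rule disjoint_family_card_le_matching_number[OF F])
    show "h ` {..s} \<subseteq> F" using AV(2) by auto
    show "disjoint (h ` {..s})" using hd by (intro disjointI) fast
  qed
  ultimately show False by simp
qed

text \<open>At most \<open>(card V choose l) - (card V - l choose l)\<close> of the
  \<open>l\<close>-sets meet \<open>B\<close>; the additive form avoids truncated
  subtraction.\<close>

lemma card_nsets_meeting:
  assumes "finite V" "B \<in> [V]\<^bsup>l\<^esup>" "G \<subseteq> [V]\<^bsup>l\<^esup>"
  shows "card G + (card V - l choose l) \<le> card {A \<in> G. A \<inter> B = {}} + (card V choose l)"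
proof -
  have finG: "finite G" using finite_subset_nsets[OF assms(3,1)] .
  have fin: "finite ([V]\<^bsup>l\<^esup>)" using assms(1) by (rule finite_imp_finite_nsets)
  have "card G = card {A \<in> G. A \<inter> B = {}} + card {A \<in> G. A \<inter> B \<noteq> {}}"
    using finG by (subst card_Un_disjoint[symmetric]) (auto intro: arg_cong[where f = card])
  moreover have "card {A \<in> G. A \<inter> B \<noteq> {}} + card ([V - B]\<^bsup>l\<^esup>) \<le> card ([V]\<^bsup>l\<^esup>)"
  proof -
    have "card {A \<in> G. A \<inter> B \<noteq> {}} + card ([V - B]\<^bsup>l\<^esup>) = card ({A \<in> G. A \<inter> B \<noteq> {}} \<union> [V - B]\<^bsup>l\<^esup>)"
      using finG assms(1) by (intro card_Un_disjoint[symmetric])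
        (auto simp: finite_imp_finite_nsets nsets_def)
    also have "\<dots> \<le> card ([V]\<^bsup>l\<^esup>)"
      using assms fin by (intro card_mono) (auto simp: nsets_def)
    finally show ?thesis .
  qed
  moreover have "card (V - B) = card V - l"
    using assms by (auto simp: nsets_def card_Diff_subset)
  ultimately show ?thesis by simp
qed

text \<open>A member \<open>B\<close> of the smallest family \<open>G 0\<close> leaves a cross-dependent sequence of one family
  less on \<open>V - B\<close>.\<close>

lemma nested_cross_dependent_nonempty_bound:
  fixes G :: "nat \<Rightarrow> 'a set set"
  assumes V: "finite V" and m: "(s + 1) * l \<le> card V" and s: "1 \<le> s"
    and G: "\<And>j. j \<le> s \<Longrightarrow> G j \<subseteq> [V]\<^bsup>l\<^esup>"
    and nested: "\<And>i j. i \<le> j \<Longrightarrow> j \<le> s \<Longrightarrow> G i \<subseteq> G j"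
    and dep: "\<not> (\<exists>A. (\<forall>j\<le>s. A j \<in> G j) \<and> (\<forall>i\<le>s. \<forall>j\<le>s. i \<noteq> j \<longrightarrow> A i \<inter> A j = {}))"
    and B: "B \<in> G 0"
  shows "(\<Sum>j=1..s. card (G j)) + (card V - l choose l) \<le> s * (card V choose l)"
proof -
  obtain r where r: "s = Suc r" using s by (cases s) auto
  have BV: "B \<in> [V]\<^bsup>l\<^esup>" using B G[of 0] by auto
  define H where "H j = {A \<in> G (Suc j). A \<inter> B = {}}" for j
  have cV: "card (V - B) = card V - l"
    using BV by (auto simp: nsets_def card_Diff_subset)
  \<comment> \<open>With \<open>s\<close> blocks and \<open>r = s - 1\<close> the factor
    \<open>s - r\<close> is 1, so the bound controls the plain sum over all of
    \<open>H 0, \<dots>, H r\<close>.\<close>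
  have "(\<Sum>j=1..r. card (H j)) + (s - r) * card (H 0) \<le> r * (card (V - B) choose l)"
  proof (rule nested_cross_dependent_bound)
    show "finite (V - B)" using V by simp
    show "s * l \<le> card (V - B)" using m cV by simp
    show "r < s" using r by simp
    show "H j \<subseteq> [V - B]\<^bsup>l\<^esup>" if "j \<le> r" for j
      using G[of "Suc j"] that r by (auto simp: H_def nsets_def)
    show "H i \<subseteq> H j" if "i \<le> j" "j \<le> r" for i j
      using nested[of "Suc i" "Suc j"] that r by (auto simp: H_def)
    show "\<not> (\<exists>A. (\<forall>j\<le>r. A j \<in> H j) \<and> (\<forall>i\<le>r. \<forall>j\<le>r. i \<noteq> j \<longrightarrow> A i \<inter> A j = {}))"
    proof
      assume "\<exists>A. (\<forall>j\<le>r. A j \<in> H j) \<and> (\<forall>i\<le>r. \<forall>j\<le>r. i \<noteq> j \<longrightarrow> A i \<inter> A j = {})"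
      then obtain A where A: "\<forall>j\<le>r. A j \<in> H j" "\<forall>i\<le>r. \<forall>j\<le>r. i \<noteq> j \<longrightarrow> A i \<inter> A j = {}"
        by blast
      define A' where "A' j = (case j of 0 \<Rightarrow> B | Suc i \<Rightarrow> A i)" for j
      have "A' j \<in> G j" if "j \<le> s" for j
        using that A(1) B r by (auto simp: A'_def H_def split: nat.split)
      moreover have "A' i \<inter> A' j = {}" if "i \<le> s" "j \<le> s" "i \<noteq> j" for i j
        using that A r by (fastforce simp: A'_def H_def split: nat.splits)
      ultimately have "(\<forall>j\<le>s. A' j \<in> G j) \<and> (\<forall>i\<le>s. \<forall>j\<le>s. i \<noteq> j \<longrightarrow> A' i \<inter> A' j = {})"
        by simp
      then show False by (rule notE[OF dep, OF exI])
    qed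
  qed
  moreover have "(\<Sum>j=1..r. card (H j)) + card (H 0) = (\<Sum>j\<le>r. card (H j))"
    by (simp add: sum.atMost_shift atLeastSucAtMost_greaterThanAtMost[symmetric]
        sum.atLeast1_atMost_eq sum.shift_bounds_cl_Suc_ivl lessThan_Suc_atMost)
  ultimately have "(\<Sum>j\<le>r. card (H j)) \<le> r * (card V - l choose l)"
    using r cV by simp
  \<comment> \<open>There are \<open>s\<close> copies of \<open>card V - l choose l\<close> here
    against \<open>r = s - 1\<close> in the bound for the \<open>H j\<close>; the one left over is
    the gain.\<close>
  moreover have "(\<Sum>j\<le>r. card (G (Suc j)) + (card V - l choose l))
      \<le> (\<Sum>j\<le>r. card (H j) + (card V choose l))"
    unfolding H_def using V BV G r by (intro sum_mono card_nsets_meeting) auto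
  moreover have "(\<Sum>j=1..s. card (G j)) = (\<Sum>j\<le>r. card (G (Suc j)))"
    unfolding r by (simp add: sum.atLeast1_atMost_eq lessThan_Suc_atMost[symmetric])
  ultimately show ?thesis
    unfolding r by (simp add: sum.distrib)
qed

text \<open>With \<open>X\<close> the deficiency of the \<open>s\<close> largest links, the two bounds above read
  \<open>X \<ge> (m - s) * card (link V (g 0) F)\<close> and \<open>X \<ge> (card V - l choose l)\<close>, and the family falls
  short of the extremal size by \<open>X - (s + 1) * card (link V (g 0) F)\<close> at least.\<close>

lemma card_le_of_nested_links:
  fixes F :: "'a set set" and g :: "nat \<Rightarrow> 'a"
  assumes V: "finite V" and g: "bij_betw g {..s} T" and TV: "T \<inter> V = {}"
    and F: "F \<subseteq> [T \<union> V]\<^bsup>k\<^esup>" and nu: "matching_number F \<le> s"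
    and k: "1 \<le> k" and s: "1 \<le> s" and m: "m * (k - 1) \<le> card V" "2 * s + 1 \<le> m"
    and nested: "\<And>i j. i \<le> j \<Longrightarrow> j \<le> s \<Longrightarrow> link V (g i) F \<subseteq> link V (g j) F"
    and B: "link V (g 0) F \<noteq> {}"
    and outside: "card {A \<in> F. A \<inter> T = {}} \<le> s * card (link V (g 0) F)"
  shows "(m - s) * card F + (m - 2 * s - 1) * (card V - (k - 1) choose (k - 1))
      + (m - s) * (card V + 1 choose k) \<le> (m - s) * (card V + s + 1 choose k)"
proof -
  define l where "l = k - 1"
  define N where "N = card V"
  define G where "G j = link V (g j) F" for j
  define Y where "Y = (\<Sum>j=1..s. card (G j))"
  have gT: "g ` {..s} = T" "inj_on g {..s}" using g by (auto simp: bij_betw_def)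
  have T: "finite T" "card T = s + 1"
    using bij_betw_same_card[OF g] gT(1) by auto
  have finF: "finite F" using finite_subset_nsets[OF F] T V by simp
  have GV: "G j \<subseteq> [V]\<^bsup>l\<^esup>" if "j \<le> s" for j
    unfolding G_def l_def by (rule link_nsets[OF F]) (use that TV gT in auto)
  have dep: "\<not> (\<exists>A. (\<forall>j\<le>s. A j \<in> G j) \<and> (\<forall>i\<le>s. \<forall>j\<le>s. i \<noteq> j \<longrightarrow> A i \<inter> A j = {}))"
    unfolding G_def by (rule links_cross_dependent[OF _ gT(2) finF nu]) (use gT TV in simp)
  have b1: "Y + (m - s) * card (G 0) \<le> s * (N choose l)"
    unfolding Y_def N_def by (rule nested_cross_dependent_bound[OF V])
      (use m s GV nested dep in \<open>auto simp: l_def G_def\<close>)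
  have "(s + 1) * l \<le> m * l" using m(2) by (intro mult_le_mono1) simp
  then have "(s + 1) * l \<le> card V" using m(1) unfolding l_def by linarith
  moreover obtain B where "B \<in> G 0" using B by (auto simp: G_def)
  ultimately have b2: "Y + (N - l choose l) \<le> s * (N choose l)"
    unfolding Y_def N_def
    using nested_cross_dependent_nonempty_bound[OF V _ s GV _ dep] nested
    by (auto simp: G_def)
  define R where "R = card {A \<in> [T \<union> V]\<^bsup>k\<^esup>. 2 \<le> card (A \<inter> T)}"
  have "(\<Sum>x\<in>T. card (link V x F)) = (\<Sum>j\<le>s. card (G j))"
    unfolding G_def using sum.reindex_bij_betw[OF g, of "\<lambda>x. card (link V x F)"] by simp
  also have "\<dots> = card (G 0) + Y"
    unfolding Y_def by (simp add: sum.atMost_shift sum.atLeast1_atMost_eq)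
  finally have links: "(\<Sum>x\<in>T. card (link V x F)) = card (G 0) + Y" .
  have "card {A \<in> F. 2 \<le> card (A \<inter> T)} \<le> R"
    unfolding R_def using F T V by (intro card_mono) (auto simp: finite_imp_finite_nsets)
  then have cF: "card F \<le> Y + (s + 1) * card (G 0) + R"
    using card_split_by_trace[OF T(1) V TV F] links outside by (simp add: G_def)
  have "{A \<in> [T \<union> V]\<^bsup>k\<^esup>. A \<inter> T = {}} = [V]\<^bsup>k\<^esup>"
    using TV by (auto simp: nsets_def)
  moreover have "(\<Sum>x\<in>T. card (link V x ([T \<union> V]\<^bsup>k\<^esup>))) = (s + 1) * (N choose l)"
    using link_all_nsets[OF _ TV k] T V by (simp add: l_def N_def)
  moreover have "card (T \<union> V) = N + s + 1"
    using T V TV by (simp add: card_Un_disjoint N_def)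
  ultimately have all: "(N + s + 1 choose k) = (N choose k) + (s + 1) * (N choose l) + R"
    using card_split_by_trace[OF T(1) V TV order_refl, of k] V by (simp add: R_def N_def)
  \<comment> \<open>\<open>N + 1 choose k\<close> counts the sets that avoid \<open>s\<close> of the
    \<open>s + 1\<close> points of \<open>T\<close>, that is, the complement of an extremal
    family.\<close>
  have pascal: "(N + 1 choose k) = (N choose k) + (N choose l)"
    using k by (cases k) (auto simp: l_def)
  define d where "d = m - (2 * s + 1)"
  have md: "m - s = d + (s + 1)" "m - 2 * s - 1 = d"
    using m(2) by (auto simp: d_def)
  define X where "X = s * (N choose l) - Y"
  have X: "s * (N choose l) = X + Y" using b2 by (simp add: X_def)
  have x1: "(d + (s + 1)) * card (G 0) \<le> X" and x2: "(N - l choose l) \<le> X"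
    using b1 b2 unfolding md X by simp_all
  \<comment> \<open>Of the \<open>m - s = d + (s + 1)\<close> copies of \<open>X\<close>, the share
    \<open>s + 1\<close> pays for the terms with \<open>card (G 0)\<close> by \<open>x1\<close>, and
    the remaining \<open>d\<close> copies each yield \<open>N - l choose l\<close> by
    \<open>x2\<close>.\<close>
  have "(d + (s + 1)) * card F + d * (N - l choose l)
      \<le> (d + (s + 1)) * (Y + (s + 1) * card (G 0) + R) + d * X"
    using cF x2 by (intro add_mono mult_le_mono) auto
  also have "\<dots> = (d + (s + 1)) * (Y + R) + (s + 1) * ((d + (s + 1)) * card (G 0)) + d * X"
    by (simp add: algebra_simps)
  also have "\<dots> \<le> (d + (s + 1)) * (Y + R) + (s + 1) * X + d * X"
    using x1 by (intro add_mono mult_le_mono) auto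
  also have "\<dots> = (d + (s + 1)) * (s * (N choose l) + R)"
    unfolding X by (simp add: algebra_simps)
  finally have "(d + (s + 1)) * card F + d * (N - l choose l) + (d + (s + 1)) * (N + 1 choose k)
      \<le> (d + (s + 1)) * (s * (N choose l) + R + (N + 1 choose k))"
    by (simp add: algebra_simps)
  also have "s * (N choose l) + R + (N + 1 choose k) = (N + s + 1 choose k)"
    unfolding all pascal by simp
  finally show ?thesis
    unfolding md l_def N_def .
qed

section \<open>Shifting and stability\<close>

definition shift_set :: "'a \<Rightarrow> 'a \<Rightarrow> 'a set set \<Rightarrow> 'a set \<Rightarrow> 'a set" where
  "shift_set a b F A =
    (if b \<in> A \<and> a \<notin> A \<and> insert a (A - {b}) \<notin> F then insert a (A - {b}) else A)"

definition shift :: "'a \<Rightarrow> 'a \<Rightarrow> 'a set set \<Rightarrow> 'a set set" where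
  "shift a b F = shift_set a b F ` F"

text \<open>Either \<open>B\<close> was already in \<open>F\<close>, and then stayed because its
  exchange is also in \<open>F\<close>, or it is new and exchanging back gives a member of
  \<open>F\<close>.\<close>

lemma shift_cases:
  assumes "B \<in> shift a b F" "a \<noteq> b"
  shows "B \<in> F \<and> (b \<in> B \<longrightarrow> a \<notin> B \<longrightarrow> insert a (B - {b}) \<in> F)
    \<or> B \<notin> F \<and> a \<in> B \<and> b \<notin> B \<and> insert b (B - {a}) \<in> F"
proof -
  obtain A where A: "A \<in> F" "B = shift_set a b F A" using assms(1) by (auto simp: shift_def)
  show ?thesis
  proof (cases "b \<in> A \<and> a \<notin> A \<and> insert a (A - {b}) \<notin> F")
    case True
    then have B: "B = insert a (A - {b})" using A by (simp add: shift_set_def)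
    then have "insert b (B - {a}) = A" using True by auto
    then show ?thesis using A True B assms(2) by auto
  next
    case False
    then have "B = A" using A by (auto simp: shift_set_def)
    then show ?thesis using False A by blast
  qed
qed

text \<open>Moved sets leave \<open>F\<close> and unmoved ones do not, so the two kinds cannot
  collide; a moved set is recovered by exchanging back.\<close>

lemma inj_on_shift_set: "inj_on (shift_set a b F) F"
proof (rule inj_onI)
  fix A B assume AB: "A \<in> F" "B \<in> F" "shift_set a b F A = shift_set a b F B"
  have rec: "insert b (insert a (C - {b}) - {a}) = C" if "b \<in> C" "a \<notin> C" for C
    using that by auto
  have moved: "shift_set a b F C \<notin> F \<and> insert b (shift_set a b F C - {a}) = C"
    if "shift_set a b F C \<noteq> C" for C
    using that rec[of C] by (simp add: shift_set_def split: if_splits)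
  show "A = B"
    using AB moved[of A] moved[of B] by metis
qed

lemma card_shift: "card (shift a b F) = card F"
  unfolding shift_def by (rule card_image[OF inj_on_shift_set])

lemma shift_nsets:
  assumes F: "F \<subseteq> [V]\<^bsup>k\<^esup>" and a: "a \<in> V"
  shows "shift a b F \<subseteq> [V]\<^bsup>k\<^esup>"
proof
  fix B assume "B \<in> shift a b F"
  then obtain A where A: "A \<in> F" "B = shift_set a b F A" by (auto simp: shift_def)
  have AV: "A \<subseteq> V" "finite A" "card A = k" using A(1) F by (auto simp: nsets_def)
  have "card (insert a (A - {b})) = card A" if "b \<in> A" "a \<notin> A"
    using that AV(2) by (simp add: card_Suc_Diff1 del: card_Diff_insert card_Diff_singleton)
  then show "B \<in> [V]\<^bsup>k\<^esup>"
    using A(2) AV a by (auto simp: shift_set_def nsets_def)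
qed

lemma transpose_image_swap:
  assumes "b \<in> A" "a \<notin> A"
  shows "transpose a b ` A = insert a (A - {b})"
proof -
  have "a \<noteq> b" using assms by auto
  have "transpose a b ` A = transpose a b ` insert b (A - {b})"
    using assms by (simp add: insert_absorb)
  also have "\<dots> = insert a (transpose a b ` (A - {b}))"
    by (simp only: image_insert transpose_apply_second)
  also have "transpose a b ` (A - {b}) = (\<lambda>x. x) ` (A - {b})"
    using assms by (intro image_cong) (auto intro!: transpose_apply_other)
  finally show ?thesis by simp
qed

text \<open>If a matching of the shifted family is not one of \<open>F\<close>, its image under the transposition of
  \<open>a\<close> and \<open>b\<close> is.\<close>

lemma matching_number_shift:
  assumes F: "finite F" "matching_number F \<le> s" and ab: "a \<noteq> b"
  shows "matching_number (shift a b F) \<le> s"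
proof -
  have "card M \<le> s" if M: "M \<subseteq> shift a b F" "disjoint M" for M
  proof (cases "M \<subseteq> F")
    case True
    then show ?thesis
      using disjoint_family_card_le_matching_number[OF F] M(2) by blast
  next
    case False
    then obtain B0 where B0: "B0 \<in> M" "B0 \<notin> F" by blast
    then have B0': "a \<in> B0" "b \<notin> B0" "insert b (B0 - {a}) \<in> F"
      using shift_cases[of B0 a b F] M(1) ab by auto
    let ?t = "transpose a b"
    have "?t ` B \<in> F" if B: "B \<in> M" for B
    proof (cases "B = B0")
      case True
      then show ?thesis
        using transpose_image_swap[of a B0 b] B0' by (simp add: transpose_commute)
    next
      case False
      \<comment> \<open>The point \<open>a\<close> is taken by \<open>B0\<close>, so no other member
        of the matching is new.\<close>
      then have aB: "a \<notin> B" using disjointD[OF M(2) B B0(1)] B0' by auto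
      then have BF: "B \<in> F" "b \<in> B \<longrightarrow> insert a (B - {b}) \<in> F"
        using shift_cases[of B a b F] M(1) B ab by auto
      show ?thesis
      proof (cases "b \<in> B")
        case True
        then show ?thesis using transpose_image_swap[OF True aB] BF by simp
      next
        case False
        have "?t ` B = (\<lambda>x. x) ` B"
          using False aB by (intro image_cong) (auto intro!: transpose_apply_other)
        then show ?thesis using BF by simp
      qed
    qed
    then have "(`) ?t ` M \<subseteq> F" by blast
    moreover have "disjoint ((`) ?t ` M)"
      using M(2) by (intro disjoint_image) (auto intro: inj_on_subset[OF inj_transpose])
    ultimately have "card ((`) ?t ` M) \<le> s"
      using disjoint_family_card_le_matching_number[OF F] by blast
    moreover have "inj_on ((`) ?t) M"
      by (rule inj_on_image) (auto intro: inj_on_subset[OF inj_transpose])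
    ultimately show ?thesis by (simp add: card_image)
  qed
  then show ?thesis
    using F(1) by (subst matching_number_le_iff) (auto simp: shift_def)
qed

text \<open>A shift that changes the family lowers the total of all elements of all members, so
  shifting terminates. The invariant \<open>P\<close> is left open because three different
  properties have to survive shifting: non-coverability, nonempty links, and a common member of the
  links.\<close>

lemma exists_shifted:
  fixes P :: "nat set set \<Rightarrow> bool"
  assumes "P F"
    and fin: "\<And>F. P F \<Longrightarrow> finite F \<and> (\<forall>A\<in>F. finite A)"
    and step: "\<And>F a b. P F \<Longrightarrow> a \<in> V \<Longrightarrow> b \<in> V \<Longrightarrow> a < b \<Longrightarrow> P (shift a b F)"
  shows "\<exists>F. P F \<and> shifted_on V F"
  using assms(1)
proof (induction "\<Sum>A\<in>F. \<Sum>A" arbitrary: F rule: less_induct)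
  case less
  note fF = fin[OF less.prems]
  show ?case
  proof (cases "shifted_on V F")
    case True
    then show ?thesis using less.prems by blast
  next
    case False
    then obtain a b A where ab: "a \<in> V" "b \<in> V" "a < b"
      and A: "A \<in> F" "b \<in> A" "a \<notin> A" "insert a (A - {b}) \<notin> F"
      by (auto simp: shifted_on_def)
    have dec: "\<Sum>(insert a (B - {b})) < \<Sum>B" if "B \<in> F" "b \<in> B" "a \<notin> B" for B
    proof -
      have "finite B" using fF that(1) by blast
      then show ?thesis using that ab(3) by (simp add: sum.remove[of B b])
    qed
    have "(\<Sum>B\<in>shift a b F. \<Sum>B) = (\<Sum>B\<in>F. \<Sum>(shift_set a b F B))"
      unfolding shift_def by (subst sum.reindex[OF inj_on_shift_set]) simp
    also have "\<dots> < (\<Sum>B\<in>F. \<Sum>B)"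
    proof (rule sum_strict_mono_ex1)
      show "finite F" using fF by blast
      show "\<forall>B\<in>F. \<Sum>(shift_set a b F B) \<le> \<Sum>B"
        using dec by (auto simp: shift_set_def less_imp_le)
      show "\<exists>B\<in>F. \<Sum>(shift_set a b F B) < \<Sum>B"
        using A dec[OF A(1-3)] by (intro bexI[of _ A]) (auto simp: shift_set_def)
    qed
    finally show ?thesis
      using less.hyps step[OF less.prems ab] by blast
  qed
qed

text \<open>A member with least sum of elements admits no further exchange.\<close>

lemma shifted_family_has_initial_segment:
  assumes G: "G \<noteq> {}" "shifted_on V G" and fin: "\<And>A. A \<in> G \<Longrightarrow> finite A \<and> A \<subseteq> V"
  shows "\<exists>A\<in>G. \<forall>b\<in>A. \<forall>a\<in>V. a < b \<longrightarrow> a \<in> A"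
proof -
  obtain A0 where "A0 \<in> G" using G(1) by blast
  then obtain A where A: "A \<in> G" "\<And>B. B \<in> G \<Longrightarrow> \<Sum>A \<le> \<Sum>B"
    using ex_has_least_nat[of "\<lambda>A. A \<in> G" A0 Sum] by blast
  have "a \<in> A" if "b \<in> A" "a \<in> V" "a < b" for a b
  proof (rule ccontr)
    assume "a \<notin> A"
    then have "insert a (A - {b}) \<in> G"
      using shifted_onD[OF G(2)] A(1) fin that by blast
    then have "\<Sum>A \<le> \<Sum>(insert a (A - {b}))" by (rule A(2))
    also have "\<dots> < \<Sum>A"
      using fin[OF A(1)] that \<open>a \<notin> A\<close> by (simp add: sum.remove[of A b])
    finally show False by simp
  qed
  then show ?thesis using A(1) by blast
qed

text \<open>If each set had a point missing from the other, the smaller of the two points would have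
  to lie in both. Hence shifted uniform families of equal rank share a member.\<close>

lemma initial_segments_eq:
  fixes A B V :: "nat set"
  assumes "finite A" "finite B" "card A = card B" "A \<subseteq> V" "B \<subseteq> V"
    and A: "\<forall>b\<in>A. \<forall>a\<in>V. a < b \<longrightarrow> a \<in> A" and B: "\<forall>b\<in>B. \<forall>a\<in>V. a < b \<longrightarrow> a \<in> B"
  shows "A = B"
proof -
  have "A \<subseteq> B \<or> B \<subseteq> A"
  proof (rule ccontr)
    assume "\<not> (A \<subseteq> B \<or> B \<subseteq> A)"
    then obtain x y where "x \<in> A" "x \<notin> B" "y \<in> B" "y \<notin> A" by blast
    then show False
      using A B assms(4,5) by (cases x y rule: linorder_cases) auto
  qed
  then show ?thesis using assms(1-3) by (metis card_subset_eq)
qed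

section \<open>Stability for families without a cover by \<open>s\<close> points\<close>

definition coverable :: "'a set \<Rightarrow> nat \<Rightarrow> 'a set set \<Rightarrow> bool" where
  "coverable V s F \<longleftrightarrow> (\<exists>T\<in>[V]\<^bsup>s\<^esup>. \<forall>A\<in>F. A \<inter> T \<noteq> {})"

text \<open>The first \<open>s + 1\<close> points play the role of \<open>T\<close>. Since
  \<open>{1..s}\<close> is no cover, some member avoids it, and shifting makes this member contain
  \<open>s + 1\<close>, so the smallest link is nonempty. A member avoiding \<open>T\<close> can
  trade any of its points for \<open>s + 1\<close>, which puts the shadow of all such members into
  that link.\<close>

lemma card_le_of_shifted:
  assumes F: "F \<subseteq> [{1..n}]\<^bsup>k\<^esup>" and nu: "matching_number F \<le> s" and sh: "shifted_on {1..n} F"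
    and nc: "\<not> coverable {1..n} s F"
    and k: "1 \<le> k" and s: "1 \<le> s" and m: "m * (k - 1) \<le> n - s - 1" "2 * s + 1 \<le> m"
    and n: "s + 1 \<le> n"
  shows "(m - s) * card F + (m - 2 * s - 1) * (n - s - 1 - (k - 1) choose (k - 1))
      + (m - s) * (n - s choose k) \<le> (m - s) * (n choose k)"
proof -
  define V where "V = {s + 2..n}"
  define T where "T = {1..s + 1}"
  \<comment> \<open>Decreasing order: smaller points have larger links, so index 0 must be the point
    \<open>s + 1\<close>.\<close>
  define g where "g j = s + 1 - j" for j
  have cV: "card V = n - s - 1" using n by (simp add: V_def)
  have TV: "T \<union> V = {1..n}" "T \<inter> V = {}" using n by (auto simp: T_def V_def)
  have g: "bij_betw g {..s} T"
    by (rule bij_betw_byWitness[where f' = g]) (auto simp: g_def T_def)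
  have finF: "finite F" using finite_subset_nsets[OF F] by simp
  have top: "insert (s + 1) (A - {b}) \<in> F" if "A \<in> F" "A \<inter> T = {}" "b \<in> A" for A b
  proof (rule shifted_onD[OF sh])
    have "b \<in> {1..n}" using F that(1,3) unfolding nsets_def by blast
    moreover have "b \<notin> T" using that by blast
    ultimately show "b \<in> {1..n}" "s + 1 < b" by (auto simp: T_def)
  qed (use that n in \<open>auto simp: T_def\<close>)
  have linkI: "A - {b} \<in> link V (s + 1) F" if "A \<in> F" "A \<inter> T = {}" "b \<in> A" for A b
  proof -
    have "A \<subseteq> T \<union> V" using F that(1) TV(1) by (auto simp: nsets_def)
    then show ?thesis using top[OF that] that(2) by (auto simp: link_def)
  qed
  have nested: "link V (g i) F \<subseteq> link V (g j) F" if ij: "i \<le> j" "j \<le> s" for i j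
  proof (cases "i = j")
    case False
    have "insert (g j) A \<in> F" if A: "A \<subseteq> V" "insert (g i) A \<in> F" for A
    proof -
      have "g x \<notin> V" for x by (simp add: V_def g_def)
      then have "g i \<notin> A" "g j \<notin> A" using A(1) by blast+
      moreover have "g j \<noteq> g i" using False ij by (auto simp: g_def)
      ultimately have "insert (g j) (insert (g i) A - {g i}) \<in> F"
        using A(2) ij n False by (intro shifted_onD[OF sh]) (auto simp: g_def)
      then show ?thesis using \<open>g i \<notin> A\<close> by simp
    qed
    then show ?thesis by (auto simp: link_def)
  qed simp
  have nonempty: "link V (g 0) F \<noteq> {}"
  proof -
    have "{1..s} \<in> [{1..n}]\<^bsup>s\<^esup>" using n by (auto simp: nsets_def)
    then obtain A where A: "A \<in> F" "A \<inter> {1..s} = {}" using nc by (auto simp: coverable_def)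
    then have AV: "A \<subseteq> {1..n}" "A \<noteq> {}" using F k by (auto simp: nsets_def)
    show ?thesis
    proof (cases "s + 1 \<in> A")
      case True
      have "A - {s + 1} \<subseteq> V"
      proof
        fix x assume x: "x \<in> A - {s + 1}"
        then have "x \<in> {1..n}" "x \<notin> {1..s}" "x \<noteq> s + 1" using A AV by auto
        then show "x \<in> V" by (auto simp: V_def)
      qed
      then have "A - {s + 1} \<in> link V (g 0) F"
        using True A by (simp add: link_def g_def insert_absorb)
      then show ?thesis by blast
    next
      case False
      have "A \<inter> T = {}" using False A(2) by (auto simp: T_def le_Suc_eq)
      then show ?thesis using linkI[OF A(1)] AV(2) by (auto simp: g_def)
    qed
  qed
  have outside: "card {A \<in> F. A \<inter> T = {}} \<le> s * card (link V (g 0) F)"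
  proof -
    let ?F0 = "{A \<in> F. A \<inter> T = {}}"
    have "?F0 \<subseteq> [V]\<^bsup>k\<^esup>" using F unfolding TV(1)[symmetric] by (auto simp: nsets_def)
    moreover have "shifted_on V ?F0"
      unfolding shifted_on_def
    proof (intro ballI impI)
      fix a b A assume *: "a \<in> V" "b \<in> V" "A \<in> ?F0" "a < b" "b \<in> A" "a \<notin> A"
      then have "insert a (A - {b}) \<in> F"
        using TV by (intro shifted_onD[OF sh]) auto
      then show "insert a (A - {b}) \<in> ?F0" using * TV by auto
    qed
    moreover have "matching_number ?F0 \<le> s"
      using finF disjoint_family_card_le_matching_number[OF finF nu]
      by (subst matching_number_le_iff) auto
    ultimately have "card ?F0 \<le> s * card (shadow ?F0)"
      using k by (intro card_le_shadow[where V = V]) (auto simp: V_def)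
    also have "\<dots> \<le> s * card (link V (g 0) F)"
    proof (intro mult_le_mono2 card_mono)
      have "link V (g 0) F \<subseteq> Pow V" by (auto simp: link_def)
      then show "finite (link V (g 0) F)" by (rule finite_subset) (simp add: V_def)
      show "shadow ?F0 \<subseteq> link V (g 0) F" using linkI by (auto simp: shadow_def g_def)
    qed
    finally show ?thesis .
  qed
  have finV: "finite V" by (simp add: V_def)
  have mV: "m * (k - 1) \<le> card V" using m(1) cV by simp
  have cV': "card V + s + 1 = n" "card V + 1 = n - s" using cV n by simp_all
  have "(m - s) * card F + (m - 2 * s - 1) * (card V - (k - 1) choose (k - 1))
      + (m - s) * (card V + 1 choose k) \<le> (m - s) * (card V + s + 1 choose k)"
    by (rule card_le_of_nested_links[OF finV g TV(2) _ nu k s mV m(2) _ nonempty outside])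
      (use F TV(1) nested in simp_all)
  then show ?thesis unfolding cV' unfolding cV .
qed

text \<open>A shift inside \<open>V\<close> does not touch \<open>x\<close>, so a witness
  \<open>insert x A\<close> is at worst moved to another set of the form
  \<open>insert x B\<close>.\<close>

lemma link_shift_nonempty:
  assumes "link V x F \<noteq> {}" "a \<in> V" "b \<in> V" "x \<notin> V"
  shows "link V x (shift a b F) \<noteq> {}"
proof -
  obtain A where A: "A \<subseteq> V" "insert x A \<in> F" using assms(1) by (auto simp: link_def)
  have "shift_set a b F (insert x A) \<in> shift a b F" using A by (simp add: shift_def)
  moreover have "\<exists>B. B \<subseteq> V \<and> shift_set a b F (insert x A) = insert x B"
  proof (cases "shift_set a b F (insert x A) = insert x A")
    case True
    then show ?thesis using A by blast
  next
    case False
    then have "shift_set a b F (insert x A) = insert a (insert x A - {b})"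
      by (auto simp: shift_set_def split: if_splits)
    also have "\<dots> = insert x (insert a (A - {b}))" using assms by auto
    finally show ?thesis using A assms by (intro exI[of _ "insert a (A - {b})"]) auto
  qed
  ultimately show ?thesis by (auto simp: link_def)
qed

text \<open>First shift inside the complement \<open>V\<close> of the cover \<open>T\<close>, after which all the links of
  the points of \<open>T\<close> contain the same initial segment of \<open>V\<close>; because of this common member the
  links stay nonempty while shifting inside \<open>T\<close>.\<close>

lemma card_le_of_cover:
  fixes F :: "nat set set"
  assumes F: "F \<subseteq> [{1..n}]\<^bsup>k\<^esup>" and nu: "matching_number F \<le> s"
    and T: "T \<in> nsets {1..n} (s + 1)" and cover: "\<forall>A\<in>F. A \<inter> T \<noteq> {}"
    and nc: "\<not> coverable {1..n} s F"
    and k: "1 \<le> k" and s: "1 \<le> s" and m: "m * (k - 1) \<le> n - s - 1" "2 * s + 1 \<le> m"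
    and n: "s + 1 \<le> n"
  shows "(m - s) * card F + (m - 2 * s - 1) * (n - s - 1 - (k - 1) choose (k - 1))
      + (m - s) * (n - s choose k) \<le> (m - s) * (n choose k)"
proof -
  define V where "V = {1..n} - T"
  have Tn: "T \<subseteq> {1..n}" "finite T" "card T = s + 1" using T by (auto simp: nsets_def)
  have TV: "T \<union> V = {1..n}" "T \<inter> V = {}" using Tn by (auto simp: V_def)
  have cV: "card V = n - s - 1" using Tn by (simp add: V_def card_Diff_subset)
  define Q where "Q H \<longleftrightarrow> H \<subseteq> [{1..n}]\<^bsup>k\<^esup> \<and> card H = card F \<and> matching_number H \<le> s
    \<and> (\<forall>A\<in>H. A \<inter> T \<noteq> {})" for H
  have Qfin: "finite H \<and> (\<forall>A\<in>H. finite A)" if "Q H" for H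
    using that finite_subset_nsets[of H "{1..n}" k] by (auto simp: Q_def nsets_def)
  \<comment> \<open>Replacing \<open>b\<close> by \<open>a\<close> can destroy the cover
    \<open>T\<close> only when \<open>b\<close> is in \<open>T\<close> and \<open>a\<close> is not;
    the side condition excludes just this.\<close>
  have Qshift: "Q (shift a b H)" if H: "Q H" and ab: "a \<in> T \<or> b \<in> V" "a \<in> {1..n}" "a < b" for H a b
  proof -
    have "B \<inter> T \<noteq> {}" if B: "B \<in> shift a b H" for B
    proof -
      obtain A where A: "A \<in> H" "B = shift_set a b H A" using B by (auto simp: shift_def)
      then have "A \<inter> T \<noteq> {}" using H by (simp add: Q_def)
      then show ?thesis using A(2) ab(1) TV(2) by (auto simp: shift_set_def)
    qed
    then show ?thesis
      using H shift_nsets[of H "{1..n}" k a b] card_shift[of a b H] ab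
        matching_number_shift[of H s a b] Qfin[OF H]
      by (auto simp: Q_def)
  qed
  have "Q F" using F nu cover by (simp add: Q_def)
  moreover have "link V x F \<noteq> {}" if x: "x \<in> T" for x
  proof -
    \<comment> \<open>These \<open>s\<close> points miss some member, which can then meet
      \<open>T\<close> only in \<open>x\<close>.\<close>
    have "T - {x} \<in> [{1..n}]\<^bsup>s\<^esup>" using Tn x by (auto simp: nsets_def)
    then obtain A where A: "A \<in> F" "A \<inter> (T - {x}) = {}" using nc by (auto simp: coverable_def)
    then have "x \<in> A" using cover by blast
    moreover have "A - {x} \<subseteq> V" using A F x by (auto simp: V_def nsets_def)
    ultimately have "A - {x} \<in> link V x F" using A by (simp add: link_def insert_absorb)
    then show ?thesis by blast
  qed
  ultimately have "\<exists>H. (Q H \<and> (\<forall>x\<in>T. link V x H \<noteq> {})) \<and> shifted_on V H"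
  proof (intro exists_shifted[of "\<lambda>H. Q H \<and> (\<forall>x\<in>T. link V x H \<noteq> {})" F V])
    show "Q (shift a b H) \<and> (\<forall>x\<in>T. link V x (shift a b H) \<noteq> {})"
      if "Q H \<and> (\<forall>x\<in>T. link V x H \<noteq> {})" "a \<in> V" "b \<in> V" "a < b" for H a b
      using that Qshift[of H a b] link_shift_nonempty[of V _ H a b] TV by blast
  qed (use Qfin in auto)
  then obtain H where H: "Q H" "\<forall>x\<in>T. link V x H \<noteq> {}" "shifted_on V H" by blast
  have ini: "\<exists>A\<in>link V x H. \<forall>b\<in>A. \<forall>a\<in>V. a < b \<longrightarrow> a \<in> A" if x: "x \<in> T" for x
  proof (rule shifted_family_has_initial_segment)
    show "link V x H \<noteq> {}" using H(2) x by blast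
    show "shifted_on V (link V x H)"
      unfolding shifted_on_def
    proof (intro ballI impI)
      fix a b A assume *: "a \<in> V" "b \<in> V" "A \<in> link V x H" "a < b" "b \<in> A" "a \<notin> A"
      then have "insert a (insert x A - {b}) \<in> H"
        using x TV by (intro shifted_onD[OF H(3)]) (auto simp: link_def)
      also have "insert a (insert x A - {b}) = insert x (insert a (A - {b}))"
        using * x TV by auto
      finally show "insert a (A - {b}) \<in> link V x H" using * by (auto simp: link_def)
    qed
    show "finite A \<and> A \<subseteq> V" if "A \<in> link V x H" for A
      using that finite_subset[of A V] by (simp add: link_def V_def)
  qed
  obtain x0 where x0: "x0 \<in> T" using Tn by fastforce
  obtain B where B: "B \<in> link V x0 H" "\<forall>b\<in>B. \<forall>a\<in>V. a < b \<longrightarrow> a \<in> B" using ini[OF x0] by blast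
  have lV: "link V x H \<subseteq> nsets V (k - 1)" if "x \<in> T" for x
    using H(1) that TV by (intro link_nsets[of H "{1..n}"]) (auto simp: Q_def)
  have BV: "B \<subseteq> V" using B by (auto simp: link_def)
  have "insert x B \<in> H" if x: "x \<in> T" for x
  proof -
    obtain A where A: "A \<in> link V x H" "\<forall>b\<in>A. \<forall>a\<in>V. a < b \<longrightarrow> a \<in> A" using ini[OF x] by blast
    have "A = B"
    proof (rule initial_segments_eq[of A B V])
      have "A \<in> nsets V (k - 1)" "B \<in> nsets V (k - 1)" using lV x x0 A B by blast+
      then show "finite A" "finite B" "card A = card B" "A \<subseteq> V" "B \<subseteq> V"
        by (auto simp: nsets_def)
    qed (use A B in auto)
    then show ?thesis using A by (simp add: link_def)
  qed
  with H(1) have "\<exists>K. (Q K \<and> (\<forall>x\<in>T. insert x B \<in> K)) \<and> shifted_on T K"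
  proof (intro exists_shifted[of "\<lambda>K. Q K \<and> (\<forall>x\<in>T. insert x B \<in> K)" H T])
    show "Q (shift a b K) \<and> (\<forall>x\<in>T. insert x B \<in> shift a b K)"
      if K: "Q K \<and> (\<forall>x\<in>T. insert x B \<in> K)" and ab: "a \<in> T" "b \<in> T" "a < b" for K a b
    proof (intro conjI ballI)
      show "Q (shift a b K)" using K ab Tn by (intro Qshift) auto
      fix x assume x: "x \<in> T"
      have "b \<notin> B" using ab BV TV by auto
      \<comment> \<open>The only set at risk is \<open>insert b B\<close>, and its exchange
        \<open>insert a B\<close> is already in \<open>K\<close>, which blocks the move.\<close>
      then have "shift_set a b K (insert x B) = insert x B"
        using K ab by (auto simp: shift_set_def)
      then show "insert x B \<in> shift a b K"
        using K x by (metis imageI shift_def)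
    qed
  qed (use Qfin in auto)
  then obtain K where K: "Q K" "\<forall>x\<in>T. insert x B \<in> K" "shifted_on T K" by blast
  obtain h where h: "bij_betw h {..<card T} T" "strict_mono_on {..<card T} h"
    using ex_bij_betw_strict_mono_card[OF Tn(2)] by blast
  have cT: "{..<card T} = {..s}" using Tn(3) by auto
  define g where "g j = h (s - j)" for j
  have "bij_betw (\<lambda>j. s - j) {..s} {..s}"
    by (rule bij_betw_byWitness[where f' = "\<lambda>j. s - j"]) auto
  then have g: "bij_betw g {..s} T"
    using bij_betw_trans[of _ _ _ h] h(1) unfolding g_def cT by (simp add: comp_def)
  have gT: "g j \<in> T" if "j \<le> s" for j using g that by (auto simp: bij_betw_def)
  have nested: "link V (g i) K \<subseteq> link V (g j) K" if ij: "i \<le> j" "j \<le> s" for i j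
  proof (cases "i = j")
    case False
    then have lt: "g j < g i"
      using strict_mono_onD[OF h(2), of "s - j" "s - i"] ij Tn(3) by (simp add: g_def)
    have "insert (g j) A \<in> K" if A: "A \<subseteq> V" "insert (g i) A \<in> K" for A
    proof -
      have "g i \<notin> A" "g j \<notin> A" using A(1) gT[of i] gT[of j] ij TV by auto
      then have "insert (g j) (insert (g i) A - {g i}) \<in> K"
        using A(2) gT ij lt by (intro shifted_onD[OF K(3)]) auto
      then show ?thesis using \<open>g i \<notin> A\<close> by simp
    qed
    then show ?thesis by (auto simp: link_def)
  qed simp
  have nonempty: "link V (g 0) K \<noteq> {}" using K(2) gT[of 0] BV by (auto simp: link_def)
  have none: "{A \<in> K. A \<inter> T = {}} = {}" using K(1) by (auto simp: Q_def)
  have outside: "card {A \<in> K. A \<inter> T = {}} \<le> s * card (link V (g 0) K)"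
    unfolding none by simp
  have KQ: "K \<subseteq> [T \<union> V]\<^bsup>k\<^esup>" "card K = card F" "matching_number K \<le> s"
    using K(1) TV(1) by (simp_all add: Q_def)
  have finV: "finite V" by (simp add: V_def)
  have mV: "m * (k - 1) \<le> card V" using m(1) cV by simp
  have cV': "card V + s + 1 = n" "card V + 1 = n - s" using cV n by simp_all
  have "(m - s) * card K + (m - 2 * s - 1) * (card V - (k - 1) choose (k - 1))
      + (m - s) * (card V + 1 choose k) \<le> (m - s) * (card V + s + 1 choose k)"
    by (rule card_le_of_nested_links[OF finV g TV(2) KQ(1,3) k s mV m(2) _ nonempty outside])
      (rule nested)
  then show ?thesis unfolding cV' unfolding cV KQ(2) .
qed

text \<open>Shift until the family is shifted, or until the next shift \<open>shift a b\<close> would make it coverable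
  by \<open>s\<close> points. In the latter case these points together with \<open>b\<close> cover the family before the shift.\<close>

theorem matching_stability:
  assumes F: "F \<subseteq> [{1..n}]\<^bsup>k\<^esup>" and nu: "matching_number F \<le> s"
    and nc: "\<not> coverable {1..n} s F"
    and k: "1 \<le> k" and s: "1 \<le> s" and m: "m * (k - 1) \<le> n - s - 1" "2 * s + 1 \<le> m"
    and n: "s + 1 \<le> n"
  shows "(m - s) * card F + (m - 2 * s - 1) * (n - s - 1 - (k - 1) choose (k - 1))
      + (m - s) * (n - s choose k) \<le> (m - s) * (n choose k)"
proof -
  define P where "P H \<longleftrightarrow> H \<subseteq> [{1..n}]\<^bsup>k\<^esup> \<and> card H = card F \<and> matching_number H \<le> s
    \<and> \<not> coverable {1..n} s H" for H
  have Pfin: "finite H \<and> (\<forall>A\<in>H. finite A)" if "P H" for H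
    using that finite_subset_nsets[of H "{1..n}" k] by (auto simp: P_def nsets_def)
  show ?thesis
  proof (cases "\<exists>H a b. P H \<and> a \<in> {1..n} \<and> b \<in> {1..n} \<and> a < b \<and> \<not> P (shift a b H)")
    case True
    then obtain H a b where H: "P H" "a \<in> {1..n}" "b \<in> {1..n}" "a < b" "\<not> P (shift a b H)" by blast
    then have "coverable {1..n} s (shift a b H)"
      using shift_nsets[of H "{1..n}" k a b] card_shift[of a b H] Pfin[OF H(1)]
        matching_number_shift[of H s a b]
      by (auto simp: P_def)
    then obtain C where C: "C \<in> [{1..n}]\<^bsup>s\<^esup>" "\<And>A. A \<in> shift a b H \<Longrightarrow> A \<inter> C \<noteq> {}"
      by (auto simp: coverable_def)
    \<comment> \<open>A member that misses \<open>C\<close> must have been moved by the shift, hence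
      contains \<open>b\<close>.\<close>
    have cov: "\<forall>A\<in>H. A \<inter> insert b C \<noteq> {}"
    proof
      fix A assume "A \<in> H"
      then have "shift_set a b H A \<inter> C \<noteq> {}" using C(2) by (simp add: shift_def)
      then show "A \<inter> insert b C \<noteq> {}" by (auto simp: shift_set_def split: if_splits)
    qed
    have "b \<notin> C"
    proof
      assume "b \<in> C"
      then have "coverable {1..n} s H"
        using cov C(1) unfolding coverable_def by (metis insert_absorb)
      then show False using H(1) by (simp add: P_def)
    qed
    then have "insert b C \<in> nsets {1..n} (s + 1)" using C(1) H(3) by (auto simp: nsets_def)
    then show ?thesis
      using card_le_of_cover[of H n k s "insert b C" m] cov H(1) k s m n by (simp add: P_def)
  next
    case False
    have "P F" using F nu nc by (simp add: P_def)
    then obtain H where "P H" "shifted_on {1..n} H"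
      using exists_shifted[of P F "{1..n}"] Pfin False by blast
    then show ?thesis
      using card_le_of_shifted[of H n k s m] k s m n by (simp add: P_def)
  qed
qed

section \<open>Minimum degrees\<close>

lemma card_supersets:
  assumes X: "finite X" and S: "S \<subseteq> X" "card S \<le> k"
  shows "card {A \<in> [X]\<^bsup>k\<^esup>. S \<subseteq> A} = (card X - card S choose (k - card S))"
proof -
  have finS: "finite S" using X S finite_subset by blast
  have "bij_betw (\<lambda>A. A - S) {A \<in> [X]\<^bsup>k\<^esup>. S \<subseteq> A} (nsets (X - S) (k - card S))"
  proof (rule bij_betw_byWitness[where f' = "\<lambda>B. B \<union> S"])
    show "(\<lambda>A. A - S) ` {A \<in> [X]\<^bsup>k\<^esup>. S \<subseteq> A} \<subseteq> nsets (X - S) (k - card S)"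
      using finS by (auto simp: nsets_def card_Diff_subset)
    show "(\<lambda>B. B \<union> S) ` nsets (X - S) (k - card S) \<subseteq> {A \<in> [X]\<^bsup>k\<^esup>. S \<subseteq> A}"
    proof (rule image_subsetI)
      fix B assume "B \<in> nsets (X - S) (k - card S)"
      then have B: "B \<subseteq> X - S" "finite B" "card B = k - card S" by (auto simp: nsets_def)
      then have "card (B \<union> S) = k"
        using finS S by (subst card_Un_disjoint) auto
      then show "B \<union> S \<in> {A \<in> [X]\<^bsup>k\<^esup>. S \<subseteq> A}"
        using B S finS by (auto simp: nsets_def)
    qed
  qed (auto simp: nsets_def)
  then show ?thesis
    using bij_betw_same_card X S finS by (fastforce simp: card_Diff_subset)
qed

lemma sum_degrees:
  assumes V: "finite V" and F: "F \<subseteq> [V]\<^bsup>k\<^esup>"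
  shows "(\<Sum>S\<in>[V]\<^bsup>t\<^esup>. card {A \<in> F. S \<subseteq> A}) = card F * (k choose t)"
proof -
  have finF: "finite F" using finite_subset_nsets[OF F V] .
  have finN: "finite ([V]\<^bsup>t\<^esup>)" using V by (rule finite_imp_finite_nsets)
  have "(\<Sum>S\<in>[V]\<^bsup>t\<^esup>. card {A \<in> F. S \<subseteq> A}) = (\<Sum>S\<in>[V]\<^bsup>t\<^esup>. \<Sum>A\<in>F. if S \<subseteq> A then 1 else 0)"
    using finF by (simp add: sum.If_cases Int_def)
  also have "\<dots> = (\<Sum>A\<in>F. \<Sum>S\<in>[V]\<^bsup>t\<^esup>. if S \<subseteq> A then 1 else 0)"
    by (rule sum.swap)
  also have "\<dots> = (\<Sum>A\<in>F. k choose t)"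
  proof (rule sum.cong[OF refl])
    fix A assume "A \<in> F"
    then have A: "A \<subseteq> V" "card A = k" using F by (auto simp: nsets_def)
    have "{S \<in> [V]\<^bsup>t\<^esup>. S \<subseteq> A} = [A]\<^bsup>t\<^esup>" using A(1) by (auto simp: nsets_def)
    then have "card {S \<in> [V]\<^bsup>t\<^esup>. S \<subseteq> A} = (k choose t)" using A(2) by simp
    then show "(\<Sum>S\<in>[V]\<^bsup>t\<^esup>. if S \<subseteq> A then 1 else 0) = (k choose t)"
      using finN by (simp add: sum.If_cases Int_def)
  qed
  finally show ?thesis by simp
qed

lemma min_degree_ge_iff:
  assumes "t \<le> n"
  shows "d \<le> min_degree n t F \<longleftrightarrow> (\<forall>S\<in>[{1..n}]\<^bsup>t\<^esup>. d \<le> card {A \<in> F. S \<subseteq> A})"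
proof -
  have eq: "{card {A \<in> F. S \<subseteq> A} | S. S \<in> [{1..n}]\<^bsup>t\<^esup>}
      = (\<lambda>S. card {A \<in> F. S \<subseteq> A}) ` [{1..n}]\<^bsup>t\<^esup>" by blast
  have "[{1..n}]\<^bsup>t\<^esup> \<noteq> {}" using assms by (simp add: nsets_eq_empty_iff)
  then show ?thesis
    unfolding min_degree_def eq by (subst Min_ge_iff) (auto simp: finite_imp_finite_nsets)
qed

lemma min_degree_le:
  assumes "S \<in> [{1..n}]\<^bsup>t\<^esup>"
  shows "min_degree n t F \<le> card {A \<in> F. S \<subseteq> A}"
proof -
  have "[{1..n}]\<^bsup>t\<^esup> \<noteq> {}" using assms by blast
  then have "t \<le> n" by (simp add: nsets_eq_empty_iff)
  then show ?thesis using min_degree_ge_iff[of t n "min_degree n t F" F] assms by blast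
qed

section \<open>Isomorphic copies of the extremal family\<close>

definition meeting_family :: "nat \<Rightarrow> nat \<Rightarrow> nat set \<Rightarrow> nat set set" where
  "meeting_family n k T = {A \<in> [{1..n}]\<^bsup>k\<^esup>. A \<inter> T \<noteq> {}}"

text \<open>A superset of \<open>S\<close> can miss \<open>T\<close> only if \<open>S\<close> does,
  so the least degree occurs at the \<open>t\<close>-sets outside \<open>T\<close>.\<close>

lemma degree_meeting_family:
  assumes T: "T \<in> [{1..n}]\<^bsup>s\<^esup>" and S: "S \<in> [{1..n}]\<^bsup>t\<^esup>" and t: "t \<le> k"
  shows "card {A \<in> meeting_family n k T. S \<subseteq> A}
    = (n - t choose (k - t)) - (if S \<inter> T = {} then n - s - t choose (k - t) else 0)"
proof -
  have S': "S \<subseteq> {1..n}" "finite S" "card S = t" and T': "T \<subseteq> {1..n}" "finite T" "card T = s"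
    using S T by (auto simp: nsets_def)
  let ?X = "{A \<in> [{1..n}]\<^bsup>k\<^esup>. S \<subseteq> A}" and ?Y = "{A \<in> [{1..n} - T]\<^bsup>k\<^esup>. S \<subseteq> A}"
  have "{A \<in> meeting_family n k T. S \<subseteq> A} = ?X - ?Y"
    by (auto simp: meeting_family_def nsets_def)
  moreover have "?Y \<subseteq> ?X" "finite ?Y"
    by (auto simp: nsets_def finite_imp_finite_nsets)
  ultimately have "card {A \<in> meeting_family n k T. S \<subseteq> A} = card ?X - card ?Y"
    by (simp add: card_Diff_subset)
  moreover have "card ?X = (n - t choose (k - t))"
    using card_supersets[of "{1..n}" S k] S' t by simp
  moreover have "card ?Y = (if S \<inter> T = {} then n - s - t choose (k - t) else 0)"
  proof (cases "S \<inter> T = {}")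
    case True
    then have "S \<subseteq> {1..n} - T" using S' by blast
    then show ?thesis
      using card_supersets[of "{1..n} - T" S k] S' T' t True by (simp add: card_Diff_subset)
  next
    case False
    then have Y: "?Y = {}" by (auto simp: nsets_def)
    show ?thesis unfolding Y using False by simp
  qed
  ultimately show ?thesis by simp
qed

lemma exists_nset_avoiding:
  assumes "T \<in> [{1..n}]\<^bsup>s\<^esup>" "s + t \<le> n"
  shows "\<exists>S\<in>[{1..n}]\<^bsup>t\<^esup>. S \<inter> T = {}"
proof -
  have "card ({1..n} - T) = n - s"
    using assms(1) by (simp add: nsets_def card_Diff_subset)
  then have "t \<le> card ({1..n} - T)" using assms(2) by simp
  then obtain S where "S \<subseteq> {1..n} - T" "card S = t" "finite S"
    by (rule obtain_subset_with_card_n)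
  then show ?thesis by (intro bexI[of _ S]) (auto simp: nsets_def)
qed

lemma min_degree_le_of_cover:
  assumes "T \<in> [{1..n}]\<^bsup>s\<^esup>" "F \<subseteq> meeting_family n k T" "s + t \<le> n" "t \<le> k"
  shows "min_degree n t F \<le> (n - t choose (k - t)) - (n - s - t choose (k - t))"
proof -
  obtain S where S: "S \<in> [{1..n}]\<^bsup>t\<^esup>" "S \<inter> T = {}"
    using exists_nset_avoiding[OF assms(1,3)] by blast
  have "finite (meeting_family n k T)"
    by (simp add: meeting_family_def finite_imp_finite_nsets)
  then have "card {A \<in> F. S \<subseteq> A} \<le> card {A \<in> meeting_family n k T. S \<subseteq> A}"
    using assms(2) by (intro card_mono) auto
  then show ?thesis
    using min_degree_le[OF S(1), of F] degree_meeting_family[OF assms(1) S(1) assms(4)] S(2)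
    by simp
qed

lemma min_degree_meeting_family:
  assumes "T \<in> [{1..n}]\<^bsup>s\<^esup>" "s + t \<le> n" "t \<le> k"
  shows "min_degree n t (meeting_family n k T) = (n - t choose (k - t)) - (n - s - t choose (k - t))"
proof (rule antisym)
  show "min_degree n t (meeting_family n k T) \<le> (n - t choose (k - t)) - (n - s - t choose (k - t))"
    using assms by (intro min_degree_le_of_cover) auto
  show "(n - t choose (k - t)) - (n - s - t choose (k - t)) \<le> min_degree n t (meeting_family n k T)"
    using assms degree_meeting_family[OF assms(1) _ assms(3)]
    by (subst min_degree_ge_iff) auto
qed

text \<open>Every \<open>A\<close> in the full family contains a \<open>t\<close>-set
  \<open>S\<close> outside \<open>T\<close>, as \<open>card (A - T) \<ge> k - s \<ge> t\<close>. The
  degree of \<open>S\<close> in the full family equals the assumed lower bound, so \<open>F\<close>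
  contains all its supersets there, \<open>A\<close> among them.\<close>

lemma eq_meeting_family_of_min_degree:
  assumes T: "T \<in> [{1..n}]\<^bsup>s\<^esup>" and F: "F \<subseteq> meeting_family n k T" and k: "s + t \<le> k"
    and deg: "(n - t choose (k - t)) - (n - s - t choose (k - t)) \<le> min_degree n t F"
  shows "F = meeting_family n k T"
proof
  show "meeting_family n k T \<subseteq> F"
  proof
    fix A assume A: "A \<in> meeting_family n k T"
    then have A': "A \<subseteq> {1..n}" "finite A" "card A = k" by (auto simp: meeting_family_def nsets_def)
    have "card A - card T \<le> card (A - T)" using T by (intro diff_card_le_card_Diff) (auto simp: nsets_def)
    then have "t \<le> card (A - T)" using T A' k by (auto simp: nsets_def)
    then obtain S where S: "S \<subseteq> A - T" "card S = t" "finite S"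
      using obtain_subset_with_card_n by metis
    then have S': "S \<in> [{1..n}]\<^bsup>t\<^esup>" "S \<inter> T = {}" using A' by (auto simp: nsets_def)
    let ?E = "{A \<in> meeting_family n k T. S \<subseteq> A}"
    have fin: "finite ?E" by (simp add: meeting_family_def finite_imp_finite_nsets)
    have "card ?E \<le> card {A \<in> F. S \<subseteq> A}"
      using degree_meeting_family[OF T S'(1), of k] S'(2) k deg min_degree_le[OF S'(1), of F] by simp
    then have "{A \<in> F. S \<subseteq> A} = ?E" using fin F by (intro card_seteq) auto
    then show "A \<in> F" using A S by blast
  qed
qed (rule F)

lemma A0_eq_meeting_family: "A0 n k s = meeting_family n k {1..s}"
  by (simp add: A0_def meeting_family_def)

lemma isomorphic_meeting_family:
  assumes T: "T \<in> [{1..n}]\<^bsup>s\<^esup>" and s: "s \<le> n"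
  shows "isomorphic_families n (meeting_family n k T) (A0 n k s)"
proof -
  have "{1..s} \<in> [{1..n}]\<^bsup>s\<^esup>" using s by (auto simp: nsets_def)
  then obtain p where p: "p permutes {1..n}" "p ` T = {1..s}"
    using exists_permutes_image[of "{1..n}" T s "{1..s}"] T by auto
  have img: "q ` A \<in> meeting_family n k (q ` U)" if "q permutes {1..n}" "A \<in> meeting_family n k U" for q A U
  proof -
    have "card (q ` A) = card A" using permutes_inj_on[OF that(1)] by (rule card_image)
    then show ?thesis
      using that permutes_in_image[OF that(1)] by (auto simp: meeting_family_def nsets_def)
  qed
  have "A \<in> (`) p ` meeting_family n k T" if A: "A \<in> meeting_family n k {1..s}" for A
  proof -
    have "inv p ` {1..s} = T"
      unfolding p(2)[symmetric] using permutes_inj[OF p(1)] by (simp add: image_inv_f_f)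
    then have "inv p ` A \<in> meeting_family n k T"
      using img[OF permutes_inv[OF p(1)] A] by simp
    moreover have "A = p ` inv p ` A"
      using permutes_surj[OF p(1)] by (simp add: image_f_inv_f)
    ultimately show ?thesis by blast
  qed
  then have "A0 n k s = (`) p ` meeting_family n k T"
    using img[OF p(1), of _ T] unfolding A0_eq_meeting_family p(2) by blast
  then show ?thesis
    using p(1) by (auto simp: isomorphic_families_def)
qed

section \<open>Numerical estimates\<close>

text \<open>Union bound: each of \<open>r\<close> removed points destroys at most a fraction
  \<open>l / N\<close> of the \<open>l\<close>-sets, so a fraction of at least
  \<open>1 - r * l / N\<close> survives.\<close>

lemma binomial_diff_le:
  assumes "r \<le> N" "1 \<le> l"
  shows "N * (N choose l) \<le> N * (N - r choose l) + r * l * (N choose l)"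
proof -
  have "(N choose l) \<le> (N - r choose l) + r * (N - 1 choose (l - 1))"
    using assms(1)
  proof (induction r)
    case (Suc r)
    obtain i where i: "N - r = Suc i" using Suc.prems by (metis Suc_diff_Suc Suc_le_lessD)
    obtain j where j: "l = Suc j" using assms(2) by (cases l) auto
    have "(N - r choose l) = (N - Suc r choose l) + (N - Suc r choose (l - 1))"
      using i j by (simp add: diff_Suc)
    moreover have "(N - Suc r choose (l - 1)) \<le> (N - 1 choose (l - 1))"
      using Suc.prems by (intro binomial_right_mono) simp
    ultimately show ?case using Suc by simp
  qed simp
  then have "N * (N choose l) \<le> N * ((N - r choose l) + r * (N - 1 choose (l - 1)))"
    by (rule mult_le_mono2)
  also have "\<dots> = N * (N - r choose l) + r * (N * (N - 1 choose (l - 1)))"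
    by (simp only: distrib_left mult.left_commute)
  also have "N * (N - 1 choose (l - 1)) = l * (N choose l)"
    using assms(2) by (subst times_binomial_minus1_eq) auto
  finally show ?thesis by (simp only: mult.assoc)
qed

text \<open>In quotient form, \<open>s * t / k * ((n - s) / (n - s * t)) * ((2 * k - s) / (2 * k - 2
  * s - 1)) < 1 - (k - 1)^2 / (n - s - 1)\<close>, where the right side is at least 1/2. The case
  list for \<open>t = 1\<close> is \<open>3 * s \<le> k\<close> over the integers, with the tight
  point \<open>s = 1\<close>, \<open>k = 3\<close> kept apart.\<close>

lemma parameter_inequality:
  fixes n k s t :: real
  assumes s: "1 \<le> s" and t: "1 \<le> t" and n: "2 * k\<^sup>2 \<le> n"
    and kst: "5 * s * t \<le> k \<or> t = 1 \<and> (3 * s + 1 \<le> k \<or> 3 * s = k \<and> 2 \<le> s \<or> s = 1 \<and> k = 3)"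
  shows "(2 * k - s) * (s * t) * (n - s) * (n - s - 1)
    < k * (n - s * t) * (2 * k - 2 * s - 1) * (n - s - 1 - (k - 1)\<^sup>2)"
proof -
  have st: "s \<le> s * t" using mult_left_mono[of 1 t s] s t by simp
  have k3: "3 * s \<le> k"
    using kst st s unfolding mult.assoc[of 5 s t] by linarith
  have k0: "3 \<le> k" "0 < k" using k3 s by auto
  have kk: "k * 3 \<le> k\<^sup>2" using mult_left_mono[of 3 k k] k0 by (simp add: power2_eq_square)
  have N: "0 < n - s - 1" "2 * (k - 1)\<^sup>2 \<le> n - s - 1"
    using n kk k3 k0 s by (simp_all add: power2_diff)
  show ?thesis
  proof (cases "5 * s * t \<le> k")
    case True
    have "s * t * (10 * k) \<le> 2 * k * k"
      using mult_right_mono[OF True, of "2 * k"] k0 by (simp add: algebra_simps)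
    moreover have "50 * (s * t) \<le> s * t * (10 * k)"
      using mult_left_mono[of 5 k "s * t"] True st s by simp
    ultimately have "50 * (s * t) \<le> n" using n by (simp add: power2_eq_square)
    \<comment> \<open>The constants are balanced: the three quotients on the left are at most 1/5,
      50/49 and 49/20, with product 1/2.\<close>
    then have n1: "49 * (n - s) \<le> 50 * (n - s * t)" using s by simp
    have ns: "0 < n - s" using N s by simp
    have "5 * s \<le> k" using True st unfolding mult.assoc[of 5 s t] by linarith
    then have a: "2 * k - s < 49 / 20 * (2 * k - 2 * s - 1)" using s by simp
    have a0: "0 \<le> 2 * k - s" "0 \<le> 2 * k - 2 * s - 1" using k3 s by auto
    have "(2 * k - s) * (s * t) * (n - s) * (n - s - 1) \<le> (2 * k - s) * (k / 5) * (n - s) * (n - s - 1)"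
      using True a0 ns N by (intro mult_right_mono mult_left_mono) auto
    also have "\<dots> < 49 / 20 * (2 * k - 2 * s - 1) * (k / 5) * (n - s) * (n - s - 1)"
      using a k0 ns N by (intro mult_strict_right_mono) auto
    also have "\<dots> = k * (49 / 50 * (n - s)) * (2 * k - 2 * s - 1) * ((n - s - 1) / 2)"
      by (simp add: field_simps)
    also have "\<dots> \<le> k * (n - s * t) * (2 * k - 2 * s - 1) * (n - s - 1 - (k - 1)\<^sup>2)"
      using n1 ns k0 a0 N by (intro mult_mono) auto
    finally show ?thesis .
  next
    case False
    then have t1: "t = 1" and c: "3 * s + 1 \<le> k \<or> 3 * s = k \<and> 2 \<le> s \<or> s = 1 \<and> k = 3"
      using kst by auto
    have ns: "0 < n - s" using N s by simp
    have "(2 * k - s) * s * (n - s - 1) < k * (2 * k - 2 * s - 1) * (n - s - 1 - (k - 1)\<^sup>2)"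
    proof (cases "s = 1 \<and> k = 3")
      case True
      then show ?thesis using n by simp
    next
      case False
      \<comment> \<open>What remains after replacing the right side by 1/2; at \<open>s = 1\<close>,
        \<open>k = 3\<close> it is negative, so that point needs the exact value.\<close>
      have "0 < 2 * k * (k - 3 * s) + 2 * s\<^sup>2 - k"
      proof (cases "3 * s + 1 \<le> k")
        case True
        then have "2 * k * 1 \<le> 2 * k * (k - 3 * s)" using k0 by (intro mult_left_mono) auto
        moreover have "0 \<le> 2 * s\<^sup>2" by simp
        ultimately show ?thesis using k0 by linarith
      next
        case False
        then have "3 * s = k" "2 \<le> s" using c \<open>\<not> (s = 1 \<and> k = 3)\<close> by auto
        moreover have "2 * s \<le> s\<^sup>2" using mult_right_mono[of 2 s s] \<open>2 \<le> s\<close> by (simp add: power2_eq_square)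
        ultimately show ?thesis by simp
      qed
      then have "(2 * k - s) * s * 2 < k * (2 * k - 2 * s - 1)"
        by (simp add: algebra_simps power2_eq_square)
      then have "(2 * k - s) * s * (n - s - 1) < k * (2 * k - 2 * s - 1) * ((n - s - 1) / 2)"
        using mult_strict_right_mono[of "(2 * k - s) * s * 2" _ "(n - s - 1) / 2"] N by simp
      also have "\<dots> \<le> k * (2 * k - 2 * s - 1) * (n - s - 1 - (k - 1)\<^sup>2)"
        using N k0 k3 s by (intro mult_left_mono) auto
      finally show ?thesis .
    qed
    then have "(2 * k - s) * s * (n - s - 1) * (n - s)
        < k * (2 * k - 2 * s - 1) * (n - s - 1 - (k - 1)\<^sup>2) * (n - s)"
      using ns by (rule mult_strict_right_mono)
    then show ?thesis unfolding t1 by (simp add: mult_ac)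
  qed
qed

text \<open>Averaging the \<open>t\<close>-degrees shows that \<open>F\<close> is too large for \<open>matching_stability\<close> with
  \<open>m = 2 * k\<close>.\<close>

lemma coverable_of_min_degree:
  assumes s: "s \<ge> 1" and t: "t \<ge> 1" and n: "n \<ge> 2 * k\<^sup>2"
    and kst: "k \<ge> 5 * s * t \<or> (t = 1 \<and> k \<ge> 3 * s)"
    and F: "F \<subseteq> [{1..n}]\<^bsup>k\<^esup>" and nu: "matching_number F \<le> s"
    and deg: "(n - t choose (k - t)) - (n - s - t choose (k - t)) \<le> min_degree n t F"
  shows "coverable {1..n} s F"
proof (rule ccontr)
  assume nc: "\<not> coverable {1..n} s F"
  have st: "s \<le> s * t" "t \<le> s * t" using s t by simp_all
  have k3: "3 * s \<le> k" "t \<le> k"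
    using kst st s unfolding mult.assoc[of 5 s t] by linarith+
  have k1: "1 \<le> k" using k3 s by simp
  have kk: "3 * k \<le> k\<^sup>2" using k3 s by (simp add: power2_eq_square)
  have bounds: "s + k \<le> n" "s * t + k \<le> n" "k * 3 \<le> n"
  proof -
    have "s * t \<le> k" using kst k3 by (auto simp: mult.assoc)
    then show "s * t + k \<le> n" "s + k \<le> n" "k * 3 \<le> n" using st(1) n kk by linarith+
  qed
  \<comment> \<open>The \<open>2 * k\<close> blocks leave \<open>2 * k\<close> points spare, enough
    for the \<open>s + 1\<close> points of \<open>T\<close>.\<close>
  have "2 * k * (k - 1) + 2 * k = 2 * k\<^sup>2"
    using k1 by (cases k) (simp_all add: power2_eq_square algebra_simps)
  then have m: "2 * k * (k - 1) \<le> n - s - 1" "2 * s + 1 \<le> 2 * k"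
    using n k3 s by linarith+
  define C where "C = (n - s - 1 choose (k - 1))"
  define Q where "Q = (n - s - 1 - (k - 1) choose (k - 1))"
  define e where "e = (n - s - t choose (k - t))"
  have stab: "(2 * k - s) * card F + (2 * k - 2 * s - 1) * Q + (2 * k - s) * (n - s choose k)
      \<le> (2 * k - s) * (n choose k)"
    unfolding Q_def using matching_stability[OF F nu nc k1 s m] bounds k1 by simp
  have "(n choose t) * ((n - t choose (k - t)) - e)
      \<le> (\<Sum>S\<in>[{1..n}]\<^bsup>t\<^esup>. card {A \<in> F. S \<subseteq> A})"
  proof -
    have "t \<le> n" using k3 bounds by linarith
    then have "\<forall>S\<in>[{1..n}]\<^bsup>t\<^esup>. (n - t choose (k - t)) - e \<le> card {A \<in> F. S \<subseteq> A}"
      using deg unfolding e_def by (subst (asm) min_degree_ge_iff) auto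
    then have "(\<Sum>S\<in>[{1..n}]\<^bsup>t\<^esup>. (n - t choose (k - t)) - e) \<le> (\<Sum>S\<in>[{1..n}]\<^bsup>t\<^esup>. card {A \<in> F. S \<subseteq> A})"
      by (intro sum_mono) auto
    then show ?thesis by simp
  qed
  also have "\<dots> = card F * (k choose t)" using sum_degrees[OF _ F] by simp
  finally have low: "(n choose t) * (n - t choose (k - t)) \<le> card F * (k choose t) + (n choose t) * e"
    by (simp add: diff_mult_distrib2)
  \<comment> \<open>Both identities count pairs of a \<open>k\<close>-set and a
    \<open>t\<close>-subset. They turn the averaged bound into \<open>((n choose k) - (n - s choose
    k) - card F) * (k choose t) \<le> ((n choose t) - (n - s choose t)) * e\<close>.\<close>
  have id1: "(n choose k) * (k choose t) = (n choose t) * (n - t choose (k - t))"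
    using k3 bounds by (intro choose_mult) auto
  have id2: "(n - s choose k) * (k choose t) = (n - s choose t) * e"
    unfolding e_def using k3 bounds by (intro choose_mult) auto
  have id3: "k * (n - s choose k) = (n - s) * C"
    unfolding C_def using k1 by (intro times_binomial_minus1_eq) simp
  \<comment> \<open>Rearranged, \<open>(n - s * t) * (a - b) \<le> s * t * b\<close> for
    \<open>a = (n choose t)\<close> and \<open>b = (n - s choose t)\<close>, which trades the
    difference for a multiple of \<open>b\<close>.\<close>
  have u1: "n * (n choose t) \<le> n * (n - s choose t) + s * t * (n choose t)"
    using bounds t by (intro binomial_diff_le) auto
  have u2: "(n - s - 1) * C \<le> (n - s - 1) * Q + (k - 1) * (k - 1) * C"
    unfolding C_def Q_def using bounds k3 s by (intro binomial_diff_le) auto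
  have Cpos: "0 < C" unfolding C_def using bounds by (simp add: zero_less_binomial_iff)
  have ktpos: "0 < (k choose t)" using k3 by simp

  define n' k' s' t' where "n' = real n" and "k' = real k" and "s' = real s" and "t' = real t"
  define f where "f = real (card F)"
  define c where "c = real (k choose t)"
  define a where "a = real (n choose t)"
  define b where "b = real (n - s choose t)"
  define d where "d = real (n - s choose k)"
  define g where "g = real (n choose k)"
  note defs = n'_def k'_def s'_def t'_def f_def c_def a_def b_def d_def g_def
  have sub: "real (2 * k - s) = 2 * k' - s'" "real (2 * k - 2 * s - 1) = 2 * k' - 2 * s' - 1"
    "real (n - s) = n' - s'" "real (n - s - 1) = n' - s' - 1" "real (k - 1) = k' - 1"
    using k3 s bounds m(2) by (simp_all add: defs of_nat_diff)
  have stab': "(2 * k' - s') * f + (2 * k' - 2 * s' - 1) * Q + (2 * k' - s') * d \<le> (2 * k' - s') * g"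
    using stab[folded of_nat_le_iff[where 'a = real]] unfolding of_nat_add of_nat_mult sub
    by (simp add: defs)
  have low': "g * c \<le> f * c + a * e"
    using low unfolding id1[symmetric] defs
    by (metis (mono_tags) of_nat_add of_nat_le_iff of_nat_mult)
  have id2': "d * c = b * e"
    using id2 unfolding defs by (metis of_nat_mult)
  have id3': "k' * d = (n' - s') * C"
    using arg_cong[OF id3, of real] unfolding of_nat_mult sub by (simp add: defs)
  have u1': "n' * a \<le> n' * b + s' * t' * a"
    using u1[folded of_nat_le_iff[where 'a = real]] by (simp add: defs)
  have u2': "(n' - s' - 1) * C \<le> (n' - s' - 1) * Q + (k' - 1)\<^sup>2 * C"
    using u2[folded of_nat_le_iff[where 'a = real]] unfolding of_nat_add of_nat_mult sub
    by (simp add: power2_eq_square)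
  have s'1: "1 \<le> s'" "1 \<le> t'" and c0: "0 < c" and C0: "0 < real C"
    using s t ktpos Cpos by (simp_all add: defs)
  have k'0: "0 < k'" "3 * s' \<le> k'" using k3 s by (simp_all add: defs)
  have nst: "0 < n' - s' * t'"
  proof -
    have "s * t < n" using bounds k1 by linarith
    then show ?thesis unfolding defs by (simp flip: of_nat_mult)
  qed
  have N0: "0 < n' - s' - 1"
  proof -
    have "s + 1 < n" using bounds k3 s by linarith
    then show ?thesis unfolding defs by linarith
  qed
  let ?M = "2 * k' - s'" and ?P = "2 * k' - 2 * s' - 1"
  have M0: "0 \<le> ?M" "0 \<le> ?P" using k'0 s'1 by linarith+
  \<comment> \<open>The deficiency \<open>g - d - f\<close> is bounded below by stability and above
    by averaging; comparing the two contradicts the parameter inequality.\<close>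
  have "?P * Q * c \<le> ?M * (g - d - f) * c"
    using stab' c0 by (intro mult_right_mono) (auto simp: algebra_simps)
  also have "\<dots> \<le> ?M * (a * e - b * e)"
  proof -
    have "(g - d - f) * c \<le> a * e - b * e"
      using low' id2' by (simp add: algebra_simps)
    from mult_left_mono[OF this M0(1)] show ?thesis by (simp only: mult.assoc)
  qed
  finally have "(n' - s' * t') * (?P * Q * c) \<le> (n' - s' * t') * (?M * (a * e - b * e))"
    using nst by (intro mult_left_mono) auto
  also have "\<dots> = ?M * e * ((n' - s' * t') * (a - b))" by (simp add: algebra_simps)
  also have "\<dots> \<le> ?M * e * (s' * t' * b)"
  proof (rule mult_left_mono)
    show "(n' - s' * t') * (a - b) \<le> s' * t' * b" using u1' by (simp add: algebra_simps)
    show "0 \<le> ?M * e" using M0(1) by (rule mult_nonneg_nonneg) simp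
  qed
  also have "\<dots> = ?M * (s' * t') * (b * e)" by (simp only: mult_ac)
  finally have "(n' - s' * t') * ?P * Q * c \<le> ?M * (s' * t') * d * c"
    unfolding id2'[symmetric] by (simp only: mult.assoc)
  then have "(n' - s' * t') * ?P * Q \<le> ?M * (s' * t') * d"
    using c0 by simp
  then have "k' * ((n' - s' * t') * ?P * Q) \<le> k' * (?M * (s' * t') * d)"
    using k'0 by simp
  also have "\<dots> = ?M * (s' * t') * ((n' - s') * C)"
    unfolding id3'[symmetric] by (simp only: mult_ac)
  finally have "k' * ((n' - s' * t') * ?P * Q) * (n' - s' - 1) \<le> ?M * (s' * t') * ((n' - s') * C) * (n' - s' - 1)"
    using N0 by (intro mult_right_mono) auto
  moreover have "k' * ((n' - s' * t') * ?P) * ((n' - s' - 1 - (k' - 1)\<^sup>2) * C)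
      \<le> k' * ((n' - s' * t') * ?P) * ((n' - s' - 1) * Q)"
  proof (rule mult_left_mono)
    show "(n' - s' - 1 - (k' - 1)\<^sup>2) * C \<le> (n' - s' - 1) * Q"
      using u2' by (simp only: left_diff_distrib)
    show "0 \<le> k' * ((n' - s' * t') * ?P)"
      using k'0(1) nst M0(2) by (intro mult_nonneg_nonneg) linarith+
  qed
  ultimately have "(k' * (n' - s' * t') * ?P * (n' - s' - 1 - (k' - 1)\<^sup>2)) * C
      \<le> (?M * (s' * t') * (n' - s') * (n' - s' - 1)) * C"
    by (simp only: mult_ac)
  then have "k' * (n' - s' * t') * ?P * (n' - s' - 1 - (k' - 1)\<^sup>2)
      \<le> ?M * (s' * t') * (n' - s') * (n' - s' - 1)"
    using C0 by simp
  moreover have "?M * (s' * t') * (n' - s') * (n' - s' - 1)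
      < k' * (n' - s' * t') * ?P * (n' - s' - 1 - (k' - 1)\<^sup>2)"
  proof (rule parameter_inequality)
    show "1 \<le> s'" "1 \<le> t'" by (fact s'1)+
    show "2 * k'\<^sup>2 \<le> n'"
      using n unfolding defs by (metis of_nat_le_iff of_nat_mult of_nat_numeral of_nat_power)
    consider "5 * s * t \<le> k" | "t = 1" "3 * s + 1 \<le> k" | "t = 1" "3 * s = k" "2 \<le> s"
      | "t = 1" "s = 1" "k = 3"
      using kst s by linarith
    then show "5 * s' * t' \<le> k' \<or> t' = 1 \<and> (3 * s' + 1 \<le> k' \<or> 3 * s' = k' \<and> 2 \<le> s' \<or> s' = 1 \<and> k' = 3)"
    proof cases
      case 1
      then have "real (5 * s * t) \<le> real k" by (simp only: of_nat_le_iff)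
      then show ?thesis by (simp add: defs)
    qed (simp_all add: defs)
  qed
  ultimately show False by linarith
qed

theorem theorem32:
  fixes n k s t :: nat and F :: "nat set set"
  assumes "n \<ge> 1" and "k \<ge> 1" and "s \<ge> 1" and "t \<ge> 1"
    and "n \<ge> 2 * k\<^sup>2"
    and "k \<ge> 5 * s * t \<or> (t = 1 \<and> k \<ge> 3 * s)"
    and "F \<subseteq> [{1..n}]\<^bsup>k\<^esup>"
    and "matching_number F \<le> s"
  shows "min_degree n t F \<le> min_degree n t (A0 n k s)
    \<and> min_degree n t (A0 n k s) = ((n - t) choose (k - t)) - ((n - s - t) choose (k - t))
    \<and> (min_degree n t F = min_degree n t (A0 n k s) \<longrightarrow> isomorphic_families n F (A0 n k s))"
proof -
  let ?D = "((n - t) choose (k - t)) - ((n - s - t) choose (k - t))"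
  have "s \<le> s * t" "t \<le> s * t" using assms(3,4) by simp_all
  then have stk: "s + t \<le> k" using assms(3,4,6) by linarith
  have "k \<le> k\<^sup>2" using assms(2) by (simp add: power2_eq_square)
  then have stn: "s + t \<le> n" using stk assms(5) by linarith
  have "{1..s} \<in> [{1..n}]\<^bsup>s\<^esup>" using stn by (auto simp: nsets_def)
  then have A0: "min_degree n t (A0 n k s) = ?D"
    unfolding A0_eq_meeting_family using stn stk by (intro min_degree_meeting_family) auto
  \<comment> \<open>Bound and uniqueness come together: a family whose minimum degree reaches
    \<open>?D\<close> is a full meeting family, so it cannot exceed \<open>?D\<close>.\<close>
  have main: "min_degree n t F \<le> ?D \<and> isomorphic_families n F (A0 n k s)"
    if deg: "?D \<le> min_degree n t F"
  proof -
    obtain T where T: "T \<in> [{1..n}]\<^bsup>s\<^esup>" "\<forall>A\<in>F. A \<inter> T \<noteq> {}"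
      using coverable_of_min_degree[OF assms(3-8) deg] by (auto simp: coverable_def)
    then have F: "F \<subseteq> meeting_family n k T"
      using assms(7) by (auto simp: meeting_family_def)
    have "F = meeting_family n k T"
      using eq_meeting_family_of_min_degree[OF T(1) F stk deg] .
    moreover have "isomorphic_families n (meeting_family n k T) (A0 n k s)"
      using T(1) stn by (intro isomorphic_meeting_family) auto
    ultimately show ?thesis
      using min_degree_le_of_cover[OF T(1) F stn] stk by simp
  qed
  then show ?thesis using A0 by (metis nle_le)
qed

end
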